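(* There is an algorithm that, given an undirected loopless graph $G=(V,E)$ on $n$ vertices with a capacity function $c\colon V\to\mathbb{N}$, together with a linear arrangement of $G$ of cutwidth $\mathrm{ctw}$, determines the minimum size of a feasible orientation of $G$ in time $2^{\mathrm{ctw}} n^{\mathcal{O}(1)}$.
   Context: An orientation of $G$ replaces each edge $\{u,v\}$ by exactly one of the arcs $(u,v)$ or $(v,u)$; it is feasible if every vertex $v$ has in-degree at most $c(v)$, and its size is the number of vertices with positive in-degree. (The minimum size of a feasible orientation equals the optimum of \textsc{Capacitated Vertex Cover}: the minimum $|S|$ over sets $S\subseteq V$ admitting an assignment of every edge to an endpoint in $S$ with each $v\in S$ assigned at most $c(v)$ edges.) A linear arrangement is a bijection $\pi\colon V\to[n]$; its cutwidth is $\max_{0\le i\le n}$ of the number of edges with one endpoint among the first $i$ vertices of $\pi$ and the other endpoint among the remaining vertices. *)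

theory Defs
  imports Main
begin

section \<open>Graphs, orientations and cutwidth\<close>

definition simple_graph :: "'a set \<Rightarrow> 'a set set \<Rightarrow> bool" where
  "simple_graph V E \<longleftrightarrow> finite V \<and> (\<forall>e\<in>E. e \<subseteq> V \<and> card e = 2)"

text \<open>A pair \<open>(u, v)\<close> is the arc from \<open>u\<close> to \<open>v\<close>.\<close>

definition orientation :: "'a set set \<Rightarrow> ('a \<times> 'a) set \<Rightarrow> bool" where
  "orientation E D \<longleftrightarrow>
     (\<forall>u v. (u, v) \<in> D \<longrightarrow> {u, v} \<in> E) \<and>
     (\<forall>u v. {u, v} \<in> E \<longrightarrow> ((u, v) \<in> D \<longleftrightarrow> (v, u) \<notin> D))"

definition indegree :: "('a \<times> 'a) set \<Rightarrow> 'a \<Rightarrow> nat" where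
  "indegree D v = card {u. (u, v) \<in> D}"

definition feasible_orientation ::
    "'a set \<Rightarrow> 'a set set \<Rightarrow> ('a \<Rightarrow> nat) \<Rightarrow> ('a \<times> 'a) set \<Rightarrow> bool" where
  "feasible_orientation V E c D \<longleftrightarrow> orientation E D \<and> (\<forall>v\<in>V. indegree D v \<le> c v)"

definition orientation_size :: "'a set \<Rightarrow> ('a \<times> 'a) set \<Rightarrow> nat" where
  "orientation_size V D = card {v \<in> V. 0 < indegree D v}"

text \<open>\<open>None\<close> means that there is no feasible orientation.\<close>

definition min_orientation_size ::
    "'a set \<Rightarrow> 'a set set \<Rightarrow> ('a \<Rightarrow> nat) \<Rightarrow> nat option" where
  "min_orientation_size V E c =
     (if \<exists>D. feasible_orientation V E c D
      then Some (LEAST k. \<exists>D. feasible_orientation V E c D \<and> orientation_size V D = k)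
      else None)"

definition linear_arrangement :: "'a set \<Rightarrow> ('a \<Rightarrow> nat) \<Rightarrow> bool" where
  "linear_arrangement V \<pi> \<longleftrightarrow> bij_betw \<pi> V {1..card V}"

definition cut_edges :: "'a set set \<Rightarrow> ('a \<Rightarrow> nat) \<Rightarrow> nat \<Rightarrow> 'a set set" where
  "cut_edges E \<pi> i = {e \<in> E. (\<exists>u\<in>e. \<pi> u \<le> i) \<and> (\<exists>v\<in>e. i < \<pi> v)}"

definition cutwidth :: "'a set \<Rightarrow> 'a set set \<Rightarrow> ('a \<Rightarrow> nat) \<Rightarrow> nat" where
  "cutwidth V E \<pi> = Max ((\<lambda>i. card (cut_edges E \<pi> i)) ` {0..card V})"


section \<open>Word RAM programs\<close>

text \<open>
  Algorithms are programs for a random access machine with words of \<open>w\<close> bits, written in a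
  structured language: finitely many named registers occur in a program, and there is a memory
  of words, addressed by words. Every arithmetic operation, comparison, register access, literal
  and memory access costs one time unit. The word length is not available to the program, and a
  computation in which some number does not fit into a word (is \<open>2 ^ w\<close> or more) gets stuck, so
  that unit costs cannot be exploited by computing with long numbers.
\<close>

datatype binop = Add | Sub | Mul | Div | Mod | Less | Equal

fun apply_op :: "binop \<Rightarrow> nat \<Rightarrow> nat \<Rightarrow> nat" where
  "apply_op Add x y = x + y"
| "apply_op Sub x y = x - y"
| "apply_op Mul x y = x * y"
| "apply_op Div x y = x div y"
| "apply_op Mod x y = x mod y"
| "apply_op Less x y = (if x < y then 1 else 0)"
| "apply_op Equal x y = (if x = y then 1 else 0)"

datatype expr =
    Lit nat
  | Reg string
  | Load expr
  | Bin binop expr expr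

record state =
  regs :: "string \<Rightarrow> nat"
  mem :: "nat \<Rightarrow> nat"

fun eval_expr :: "expr \<Rightarrow> state \<Rightarrow> nat" where
  "eval_expr (Lit k) s = k"
| "eval_expr (Reg x) s = regs s x"
| "eval_expr (Load a) s = mem s (eval_expr a s)"
| "eval_expr (Bin f a b) s = apply_op f (eval_expr a s) (eval_expr b s)"

text \<open>\<open>fits w a s\<close>: all values that arise in the evaluation of \<open>a\<close>, addresses included, are
  words of \<open>w\<close> bits.\<close>

fun fits :: "nat \<Rightarrow> expr \<Rightarrow> state \<Rightarrow> bool" where
  "fits w (Lit k) s \<longleftrightarrow> k < 2 ^ w"
| "fits w (Reg x) s \<longleftrightarrow> regs s x < 2 ^ w"
| "fits w (Load a) s \<longleftrightarrow> fits w a s \<and> mem s (eval_expr a s) < 2 ^ w"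
| "fits w (Bin f a b) s \<longleftrightarrow>
     fits w a s \<and> fits w b s \<and> apply_op f (eval_expr a s) (eval_expr b s) < 2 ^ w"

fun expr_cost :: "expr \<Rightarrow> nat" where
  "expr_cost (Lit k) = 1"
| "expr_cost (Reg x) = 1"
| "expr_cost (Load a) = 1 + expr_cost a"
| "expr_cost (Bin f a b) = 1 + expr_cost a + expr_cost b"

datatype prog =
    Skip
  | Assign string expr
  | Store expr expr
  | Seq prog prog
  | If expr prog prog
  | While expr prog

text \<open>\<open>exec w P s t s'\<close>: on words of \<open>w\<close> bits, \<open>P\<close> started in \<open>s\<close> halts after \<open>t\<close> time units
  in \<open>s'\<close>. Conditions hold if they evaluate to a nonzero number.\<close>

inductive exec :: "nat \<Rightarrow> prog \<Rightarrow> state \<Rightarrow> nat \<Rightarrow> state \<Rightarrow> bool" for w :: nat where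
  Skip: "exec w Skip s 1 s"
| Assign: "fits w a s \<Longrightarrow>
    exec w (Assign x a) s (1 + expr_cost a) (s\<lparr>regs := (regs s)(x := eval_expr a s)\<rparr>)"
| Store: "fits w a s \<Longrightarrow> fits w b s \<Longrightarrow>
    exec w (Store a b) s (1 + expr_cost a + expr_cost b)
      (s\<lparr>mem := (mem s)(eval_expr a s := eval_expr b s)\<rparr>)"
| Seq: "exec w P s t s' \<Longrightarrow> exec w Q s' t' s'' \<Longrightarrow> exec w (Seq P Q) s (t + t') s''"
| IfTrue: "fits w a s \<Longrightarrow> eval_expr a s \<noteq> 0 \<Longrightarrow> exec w P s t s' \<Longrightarrow>
    exec w (If a P Q) s (1 + expr_cost a + t) s'"
| IfFalse: "fits w a s \<Longrightarrow> eval_expr a s = 0 \<Longrightarrow> exec w Q s t s' \<Longrightarrow>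
    exec w (If a P Q) s (1 + expr_cost a + t) s'"
| WhileFalse: "fits w a s \<Longrightarrow> eval_expr a s = 0 \<Longrightarrow> exec w (While a P) s (1 + expr_cost a) s"
| WhileTrue: "fits w a s \<Longrightarrow> eval_expr a s \<noteq> 0 \<Longrightarrow> exec w P s t s' \<Longrightarrow>
    exec w (While a P) s' t' s'' \<Longrightarrow> exec w (While a P) s (1 + expr_cost a + t + t') s''"

inductive_cases exec_SkipE: "exec w Skip s t s'"
inductive_cases exec_AssignE: "exec w (Assign x a) s t s'"
inductive_cases exec_StoreE: "exec w (Store a b) s t s'"
inductive_cases exec_SeqE: "exec w (Seq P Q) s t s'"
inductive_cases exec_IfE: "exec w (If a P Q) s t s'"
inductive_cases exec_WhileE: "exec w (While a P) s t s'"

lemma exec_deterministic: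
  assumes "exec w P s t1 s1" "exec w P s t2 s2"
  shows "t1 = t2 \<and> s1 = s2"
  using assms
proof (induction arbitrary: t2 s2 rule: exec.induct)
  case (Seq P s t s' Q t' s'')
  from Seq.prems obtain u r u' where *: "exec w P s u r" "exec w Q r u' s2" "t2 = u + u'"
    by (rule exec_SeqE)
  from Seq.IH(1)[OF *(1)] have "t = u" "s' = r" by simp_all
  with Seq.IH(2)[of u' s2] * show ?case by simp
next
  case (IfTrue a s P t s' Q)
  from IfTrue.prems obtain u where "exec w P s u s2" "t2 = 1 + expr_cost a + u"
    by (rule exec_IfE) (use IfTrue.hyps in simp_all)
  with IfTrue.IH[of u s2] show ?case by simp
next
  case (IfFalse a s Q t s' P)
  from IfFalse.prems obtain u where "exec w Q s u s2" "t2 = 1 + expr_cost a + u"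
    by (rule exec_IfE) (use IfFalse.hyps in simp_all)
  with IfFalse.IH[of u s2] show ?case by simp
next
  case (WhileFalse a s P)
  from WhileFalse.prems show ?case
    by (rule exec_WhileE) (use WhileFalse.hyps in simp_all)
next
  case (WhileTrue a s P t s' t' s'')
  from WhileTrue.prems obtain u r u' where
    *: "exec w P s u r" "exec w (While a P) r u' s2" "t2 = 1 + expr_cost a + u + u'"
    by (rule exec_WhileE) (use WhileTrue.hyps in simp_all)
  from WhileTrue.IH(1)[OF *(1)] have "t = u" "s' = r" by simp_all
  with WhileTrue.IH(2)[of u' s2] * show ?case by simp
qed (erule exec_SkipE exec_AssignE exec_StoreE, simp)+

section \<open>Input and output\<close>

text \<open>
  The vertices are \<open>0, \<dots>, n - 1\<close>. The memory initially holds \<open>n\<close>, the \<open>n\<close> capacities, the \<open>n\<close>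
  positions in the arrangement, and the adjacency matrix row by row, followed by zeros.
\<close>

definition input_state :: "nat \<Rightarrow> nat set set \<Rightarrow> (nat \<Rightarrow> nat) \<Rightarrow> (nat \<Rightarrow> nat) \<Rightarrow> state" where
  "input_state n E c \<pi> =
     \<lparr>regs = (\<lambda>x. 0),
      mem = (\<lambda>a.
        if a = 0 then n
        else if a < 1 + n then c (a - 1)
        else if a < 1 + 2 * n then \<pi> (a - (1 + n))
        else if a < 1 + 2 * n + n * n then
          (let j = a - (1 + 2 * n) in if {j div n, j mod n} \<in> E then 1 else 0)
        else 0)\<rparr>"

definition output_value :: "state \<Rightarrow> nat option" where
  "output_value s = (if regs s ''feasible'' = 0 then None else Some (regs s ''size''))"

end

theory Submission
  imports Defs
begin

text \<open>
  Dynamic programming along the arrangement. A state of the sweep is an orientation of the edges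
  across the current cut together with the number of arcs already counted into the current vertex;
  the table stores the least number of finished vertices of positive indegree. At the next vertex
  the edges to the left are forgotten before the edges to the right are inserted, one edge at a
  time, so that the bit vectors never get longer than the larger of the two cuts, and only the
  count remembers the forgotten orientations. Treating all edges of a vertex at once would lead
  to pairs of bit vectors and to \<open>4 ^ ctw\<close>.
\<close>

section \<open>Tables\<close>

text \<open>Each half step searches through all \<open>n * n\<close> edge numbers and all
  \<open>n\<close> vertices. This costs only a polynomial factor and avoids storing the inverse
  arrangement or a list of the current cut. Active edges are kept in increasing order of their
  numbers, so the bit of an edge sits at the number of kept edges below it, which the program tracks
  as a power of two in register \<open>p\<close>. Doubling the positions makes room for a time just
  before each vertex, when its left edges are gone and its right edges are not yet there. Whether an
  edge is active at times \<open>h\<close> and \<open>h + 1\<close> then decides between keeping,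
  forgetting, inserting and ignoring it. A table is specified through the existence of total
  orientations below a threshold, so partial orientations never have to be glued together. On the
  machine side the obstacle is that every intermediate number must be a word although the program
  does not know the word length. Hence infinity must not grow: all entries stay at most
  \<open>N\<close>, and all index computations are bounded by a polynomial multiple of
  \<open>2 ^ ctw\<close>.\<close>

abbreviation code :: "bool list \<Rightarrow> nat" where
  "code \<equiv> horner_sum of_bool 2"

lemma code_append: "code (xs @ ys) = code xs + 2 ^ length xs * code ys"
  by (induction xs) (simp_all add: algebra_simps)

lemma code_less: "code xs < 2 ^ length xs"
proof (induction xs)
  case (Cons x xs)
  then have "2 * code xs + 1 < 2 * 2 ^ length xs" by simp
  then show ?case by auto
qed simp

lemma digits_unique:
  fixes u v :: nat
  assumes "u < m" "u' < m"
  shows "u + m * v = u' + m * v' \<longleftrightarrow> u = u' \<and> v = v'"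
proof
  assume *: "u + m * v = u' + m * v'"
  have "(u + m * v) mod m = u" "(u' + m * v') mod m = u'" using assms by simp_all
  moreover have "(u + m * v) div m = v" "(u' + m * v') div m = v'"
    using assms by (simp_all add: div_mult_self2)
  ultimately show "u = u' \<and> v = v'" using * by metis
qed simp

lemma code_append_eq:
  assumes "l < 2 ^ length xs"
  shows "code (xs @ ys) = l + 2 ^ length xs * m \<longleftrightarrow> code xs = l \<and> code ys = m"
  unfolding code_append using digits_unique[OF code_less assms] .

lemma code_append_Cons_eq:
  assumes "l < 2 ^ length xs"
  shows "code (xs @ e # ys) = l + 2 ^ length xs * (of_bool \<beta> + 2 * m) \<longleftrightarrow>
    code xs = l \<and> e = \<beta> \<and> code ys = m"
  unfolding code_append_eq[OF assms] using digits_unique[of "of_bool e" 2 "of_bool \<beta>"] by auto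

lemma index_div_mod:
  assumes "d \<le> n"
  shows "(x * Suc n + d) div Suc n = x" "(x * Suc n + d) mod Suc n = d"
  using assms div_mult_self3[of "Suc n" x d] mod_mult_self3[of x "Suc n" d] by simp_all

text \<open>Minimum over the possible indegrees \<open>d\<close> of the vertex being finished, with
  capacity \<open>C\<close>; a positive indegree costs 1. The recursion copies the inner loop of
  \<open>finish_body\<close>, for which it serves as loop invariant.\<close>

fun best :: "(nat \<Rightarrow> nat) \<Rightarrow> nat \<Rightarrow> nat \<Rightarrow> nat \<Rightarrow> nat" where
  "best T C y 0 = T y"
| "best T C y (Suc j) =
     (if Suc j \<le> C then min (best T C y j) (T (y + Suc j) + 1) else best T C y j)"

lemma best_le_iff:
  "best T C y j \<le> k \<longleftrightarrow> (\<exists>d\<le>j. d \<le> C \<and> T (y + d) + of_bool (0 < d) \<le> k)"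
proof (induction j)
  case (Suc j)
  show ?case using Suc by (auto simp: le_Suc_eq)
qed simp

lemma best_le: "best T C y j \<le> T y"
  by (induction j) auto

text \<open>
  Tables are indexed by \<open>x * N + d\<close> with \<open>N = n + 1\<close>, where \<open>x\<close> is the code of a bit vector and
  \<open>d \<le> n\<close> is the count; values of \<open>N\<close> or more mean infinity. The parameter \<open>m\<close> of the forget and
  insert operations is \<open>2 ^ p\<close> for the position \<open>p\<close> of the bit.
\<close>

definition init_table :: "nat \<Rightarrow> nat \<Rightarrow> nat" where
  "init_table N y = (if y = 0 then 0 else N)"

text \<open>Index in the old table: a zero bit is opened at position \<open>p\<close>, shifting the
  higher bits up, and the count is kept.\<close>

definition forget_index :: "nat \<Rightarrow> nat \<Rightarrow> nat \<Rightarrow> nat" where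
  "forget_index N m y = (y div N div m * (2 * m) + y div N mod m) * N + y mod N"

text \<open>The forgotten edge has its right end at the current vertex. Adding \<open>m * N\<close>
  sets its bit, so that the edge points to this vertex; subtracting 1 then goes back to the count
  before this arc.\<close>

definition forget_table :: "nat \<Rightarrow> nat \<Rightarrow> (nat \<Rightarrow> nat) \<Rightarrow> nat \<Rightarrow> nat" where
  "forget_table N m T y =
    (if 0 < y mod N
     then min (T (forget_index N m y)) (T (forget_index N m y + m * N - 1))
     else T (forget_index N m y))"

text \<open>Inverse direction: the bit at position \<open>p\<close> is deleted from the
  code.\<close>

definition insert_index :: "nat \<Rightarrow> nat \<Rightarrow> nat \<Rightarrow> nat" where
  "insert_index N m y = (y div N div (2 * m) * m + y div N mod m) * N + y mod N"

text \<open>The inserted edge has its left end at the current vertex. Bit 1 points away from it and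
  leaves the count alone; bit 0 points to it, which is impossible with count 0.\<close>

definition insert_table :: "nat \<Rightarrow> nat \<Rightarrow> (nat \<Rightarrow> nat) \<Rightarrow> nat \<Rightarrow> nat" where
  "insert_table N m T y =
    (if odd (y div N div m) then T (insert_index N m y)
     else if 0 < y mod N then T (insert_index N m y - 1)
     else N)"

text \<open>The next vertex starts with count 0, so only these entries stay finite; there
  \<open>y\<close> is the first index of a row of \<open>N\<close> counts.\<close>

definition finish_table :: "nat \<Rightarrow> nat \<Rightarrow> (nat \<Rightarrow> nat) \<Rightarrow> nat \<Rightarrow> nat" where
  "finish_table N C T y = (if y mod N = 0 then best T C y (N - 1) else N)"

text \<open>Keeps infinity from growing, so that entries remain words. The added 1 in
  \<open>best\<close> does no harm, because \<open>d = 0\<close> is always a candidate and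
  \<open>T y\<close> caps the minimum.\<close>

lemma table_bounds:
  assumes "\<And>i. T i \<le> N"
  shows "init_table N y \<le> N" "forget_table N m T y \<le> N" "insert_table N m T y \<le> N"
    "finish_table N C T y \<le> N"
  using assms order_trans[OF best_le[of T C y] assms]
  by (simp_all add: init_table_def forget_table_def insert_table_def finish_table_def min.coboundedI1)

section \<open>The sweep\<close>

text \<open>
  \<open>Q\<close> is the set of edges (as numbers) and \<open>a q < b q\<close> and \<open>pos v\<close> are doubled positions in the
  arrangement. At the even time \<open>2 * i\<close> the edges of the \<open>i\<close>-th cut are active; at the odd time
  \<open>2 * i - 1\<close> those of them that avoid the \<open>i\<close>-th vertex. Hence the step from an even time only
  forgets edges and the step from an odd time only inserts edges.
\<close>

locale sweep =
  fixes n :: nat and Q :: "nat set" and a b pos c :: "nat \<Rightarrow> nat"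
  assumes Q_less: "q \<in> Q \<Longrightarrow> q < n * n"
    and even_a: "even (a q)" and even_b: "even (b q)"
    and a_less_b: "q \<in> Q \<Longrightarrow> a q < b q"
    and a_pos: "q \<in> Q \<Longrightarrow> 0 < a q"
    and b_le: "q \<in> Q \<Longrightarrow> b q \<le> 2 * n"
    and inj_pos: "inj_on pos {..<n}"
    and pos_image: "pos ` {..<n} = (\<lambda>i. 2 * i) ` {1..n}"
begin

lemma finite_Q: "finite Q"
  by (rule finite_subset[of _ "{..<n * n}"]) (auto simp: Q_less)

text \<open>\<open>\<omega> q\<close> means that \<open>q\<close> is oriented to its right end; \<open>hp\<close> is for head position.\<close>

definition hp :: "(nat \<Rightarrow> bool) \<Rightarrow> nat \<Rightarrow> nat" where
  "hp \<omega> q = (if \<omega> q then b q else a q)"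

definition indeg :: "(nat \<Rightarrow> bool) \<Rightarrow> nat \<Rightarrow> nat" where
  "indeg \<omega> j = card {q \<in> Q. hp \<omega> q = j}"

text \<open>Finished vertices are those with \<open>pos v \<le> h\<close>. Edges with both ends
  beyond \<open>h\<close> have no influence, so a total \<open>\<omega>\<close> imposes no more here
  than a partial orientation would.\<close>

definition good :: "nat \<Rightarrow> (nat \<Rightarrow> bool) \<Rightarrow> nat \<Rightarrow> bool" where
  "good h \<omega> k \<longleftrightarrow> (\<forall>v<n. pos v \<le> h \<longrightarrow> indeg \<omega> (pos v) \<le> c v) \<and>
     card {v. v < n \<and> pos v \<le> h \<and> 0 < indeg \<omega> (pos v)} \<le> k"

text \<open>One pair of inequalities serves both parities, as all ends lie at even positions: for
  even \<open>h\<close> it says \<open>a q \<le> h < b q\<close>, for odd \<open>h\<close> it also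
  excludes the edges with an end at \<open>h + 1\<close>.\<close>

definition active :: "nat \<Rightarrow> nat \<Rightarrow> bool" where
  "active h q \<longleftrightarrow> q \<in> Q \<and> a q \<le> h \<and> h + 1 < b q"

abbreviation kept :: "nat \<Rightarrow> nat \<Rightarrow> nat list" where
  "kept h r \<equiv> filter (active (Suc h)) [0..<r]"

text \<open>The active edges when the step from time \<open>h\<close> to \<open>h + 1\<close> has dealt with the edges below \<open>r\<close>.\<close>

definition queue :: "nat \<Rightarrow> nat \<Rightarrow> nat list" where
  "queue h r = kept h r @ filter (active h) [r..<n * n]"

text \<open>
  The edges that have been counted at the current vertex, which has position \<open>h + 1\<close> or \<open>h + 2\<close>
  according to the parity of \<open>h\<close>.
\<close>

definition counted :: "nat \<Rightarrow> nat \<Rightarrow> nat set" where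
  "counted h r = {q \<in> Q. b q = h + 1 \<or> q < r \<and> (b q = h + 2 \<or> a q = h + 1)}"

text \<open>Only one of \<open>h + 1\<close> and \<open>h + 2\<close> is even and thus a head
  position, so the two-element set stands for the current vertex whatever the parity.\<close>

definition part :: "nat \<Rightarrow> nat \<Rightarrow> (nat \<Rightarrow> bool) \<Rightarrow> nat" where
  "part h r \<omega> = card {q \<in> counted h r. hp \<omega> q \<in> {h + 1, h + 2}}"

text \<open>Since \<open>\<omega>\<close> orients all edges, forgetting a bit only drops a
  constraint on it, and inserting one only redefines it at a single edge.\<close>

definition sols :: "nat \<Rightarrow> nat \<Rightarrow> nat \<Rightarrow> nat \<Rightarrow> nat \<Rightarrow> bool" where
  "sols h r x d k \<longleftrightarrow> (\<exists>\<omega>. code (map \<omega> (queue h r)) = x \<and> part h r \<omega> = d \<and> good h \<omega> k)"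

text \<open>
  Comparing with thresholds \<open>k \<le> n\<close> only leaves the representation of infinity open, and turns
  minima into disjunctions.
\<close>

definition table :: "nat \<Rightarrow> nat \<Rightarrow> (nat \<Rightarrow> nat) \<Rightarrow> bool" where
  "table h r T \<longleftrightarrow> (\<forall>x<2 ^ length (queue h r). \<forall>d\<le>n. \<forall>k\<le>n. T (x * Suc n + d) \<le> k \<longleftrightarrow> sols h r x d k)"

section \<open>Effect of a single edge on the queue, the count and the table\<close>

lemma queue_Suc:
  assumes "r < n * n"
  shows "queue h r = kept h r @ (if active h r then [r] else []) @ filter (active h) [Suc r..<n * n]"
    and "queue h (Suc r) =
      kept h r @ (if active (Suc h) r then [r] else []) @ filter (active h) [Suc r..<n * n]"
  using assms by (simp_all add: queue_def upt_conv_Cons)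

text \<open>Parity makes the two cases exclusive: \<open>b r = h + 2\<close> forces \<open>h\<close>
  to be even and \<open>a r = h + 1\<close> forces it to be odd. In both cases
  \<open>b r \<noteq> h + 1\<close>, so \<open>r\<close> has not been counted before.\<close>

lemma part_Suc:
  "part h (Suc r) \<omega> =
    part h r \<omega> + of_bool (r \<in> Q \<and> (b r = h + 2 \<and> \<omega> r \<or> a r = h + 1 \<and> \<not> \<omega> r))"
proof -
  have fin: "finite {q \<in> counted h r. hp \<omega> q \<in> {h + 1, h + 2}}"
    using finite_Q by (simp add: counted_def)
  let ?P = "r \<in> Q \<and> (b r = h + 2 \<and> \<omega> r \<or> a r = h + 1 \<and> \<not> \<omega> r)"
  have *: "r \<in> counted h (Suc r) \<and> hp \<omega> r \<in> {h+1,h+2} \<longleftrightarrow>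
      ?P \<or> (r \<in> counted h r \<and> hp \<omega> r \<in> {h+1,h+2})"
    using even_a[of r] even_b[of r] a_less_b[of r] by (auto simp: counted_def hp_def)
  have **: "r \<notin> counted h r" if ?P
    using that even_a[of r] even_b[of r] a_less_b[of r] by (auto simp: counted_def)
  have other: "q \<in> counted h (Suc r) \<longleftrightarrow> q \<in> counted h r" if "q \<noteq> r" for q
    using that by (auto simp: counted_def less_Suc_eq)
  show ?thesis
  proof (cases ?P)
    case True
    have "{q \<in> counted h (Suc r). hp \<omega> q \<in> {h + 1, h + 2}} =
        insert r {q \<in> counted h r. hp \<omega> q \<in> {h + 1, h + 2}}"
      (is "?L = insert r ?R")
    proof (rule set_eqI)
      show "q \<in> ?L \<longleftrightarrow> q \<in> insert r ?R" for q
        using True * other[of q] by (cases "q = r") simp_all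
    qed
    then show ?thesis using True ** fin by (simp add: part_def)
  next
    case False
    with * have "r \<in> counted h (Suc r) \<and> hp \<omega> r \<in> {h+1,h+2} \<longleftrightarrow>
        r \<in> counted h r \<and> hp \<omega> r \<in> {h+1,h+2}" by argo
    then have "{q \<in> counted h (Suc r). hp \<omega> q \<in> {h + 1, h + 2}} =
        {q \<in> counted h r. hp \<omega> q \<in> {h + 1, h + 2}}" (is "?L = ?R")
    proof (intro set_eqI)
      fix q
      assume "r \<in> counted h (Suc r) \<and> hp \<omega> r \<in> {h+1,h+2} \<longleftrightarrow>
        r \<in> counted h r \<and> hp \<omega> r \<in> {h+1,h+2}"
      then show "q \<in> ?L \<longleftrightarrow> q \<in> ?R"
        using other[of q] unfolding mem_Collect_eq by (cases "q = r") simp_all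
    qed
    then show ?thesis using False by (simp add: part_def)
  qed
qed

text \<open>An edge changes the count only when it leaves or enters the queue:
  \<open>b r = h + 2\<close> makes it active at \<open>h\<close> only, \<open>a r = h + 1\<close> at
  \<open>h + 1\<close> only.\<close>

lemma table_skip:
  assumes "r < n * n" "active h r \<longleftrightarrow> active (Suc h) r"
  shows "table h (Suc r) T \<longleftrightarrow> table h r T" "queue h (Suc r) = queue h r"
proof -
  show q: "queue h (Suc r) = queue h r"
    using queue_Suc[OF assms(1)] assms(2) by simp
  have "\<not> (r \<in> Q \<and> (b r = h + 2 \<or> a r = h + 1))"
    using assms(2) even_a[of r] even_b[of r] a_less_b[of r] unfolding active_def
    by (metis Suc_eq_plus1 add_2_eq_Suc' even_Suc le_SucE less_antisym less_irrefl less_or_eq_imp_le not_less_eq not_less_eq_eq not_less)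
  then have "part h (Suc r) \<omega> = part h r \<omega>" for \<omega>
    by (auto simp: part_Suc)
  then show "table h (Suc r) T \<longleftrightarrow> table h r T"
    by (simp add: table_def sols_def q)
qed

text \<open>A solution for the shorter queue gives \<open>\<omega> r\<close> one of two values. Each
  corresponds to one old entry, and the minimum of the two becomes a disjunction at threshold
  \<open>k\<close>.\<close>

lemma table_forget:
  assumes r: "r < n * n" and act: "active h r" "\<not> active (Suc h) r" and T: "table h r T"
  shows "table h (Suc r) (forget_table (Suc n) (2 ^ length (kept h r)) T)"
    and "length (queue h r) = Suc (length (queue h (Suc r)))"
proof -
  define A where "A = kept h r"
  define B where "B = filter (active h) [Suc r..<n * n]"
  define m :: nat where "m = 2 ^ length A"
  have q: "queue h r = A @ r # B" "queue h (Suc r) = A @ B"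
    using queue_Suc[OF r] act by (simp_all add: A_def B_def)
  then show "length (queue h r) = Suc (length (queue h (Suc r)))" by simp
  have "r \<in> Q" "b r = h + 2" "a r \<le> h" using act by (auto simp: active_def)
  then have part: "part h (Suc r) \<omega> = part h r \<omega> + of_bool (\<omega> r)" for \<omega>
    by (simp add: part_Suc)
  have "forget_table (Suc n) m T (x * Suc n + d) \<le> k \<longleftrightarrow> sols h (Suc r) x d k"
    if x: "x < 2 ^ length (queue h (Suc r))" and d: "d \<le> n" and k: "k \<le> n" for x d k
  proof -
    define l where "l = x mod m"
    define u where "u = x div m"
    have l: "l < m" by (simp add: l_def m_def)
    have x_eq: "x = l + m * u" by (simp add: l_def u_def)
    have "u < 2 ^ length B"
      using x by (simp add: q m_def u_def power_add less_mult_imp_div_less mult.commute)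
    then have u: "u + 1 \<le> 2 ^ length B" by simp
    have bnd: "l + m * (of_bool \<beta> + 2 * u) < 2 ^ length (queue h r)" for \<beta>
    proof -
      have "l + m * (of_bool \<beta> + 2 * u) < m + m * (1 + 2 * u)"
        using l by (intro add_less_le_mono mult_le_mono) auto
      also have "\<dots> = 2 * m * (u + 1)" by (simp add: algebra_simps)
      also have "\<dots> \<le> 2 * m * 2 ^ length B" using u by (intro mult_le_mono) auto
      also have "\<dots> = 2 ^ length (queue h r)" by (simp add: q m_def power_add)
      finally show ?thesis .
    qed
    have Tle: "T (y * Suc n + e) \<le> k \<longleftrightarrow> sols h r y e k"
      if "y < 2 ^ length (queue h r)" "e \<le> n" for y e
      using T k that unfolding table_def by blast
    note dv = index_div_mod(1)[OF d, of x] and md = index_div_mod(2)[OF d, of x]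
    have ix: "forget_index (Suc n) m (x * Suc n + d) = (l + m * (of_bool False + 2 * u)) * Suc n + d"
      unfolding forget_index_def dv md by (simp add: l_def u_def algebra_simps)
    \<comment> \<open>With \<open>0 < d\<close> the subtraction stays within the row of the code, so
      it changes the count and nothing else.\<close>
    have ix': "forget_index (Suc n) m (x * Suc n + d) + m * Suc n - 1 =
        (l + m * (of_bool True + 2 * u)) * Suc n + (d - 1)" if "0 < d"
      using that unfolding ix by (simp add: algebra_simps)
    have t0: "T (forget_index (Suc n) m (x * Suc n + d)) \<le> k \<longleftrightarrow>
        sols h r (l + m * (of_bool False + 2 * u)) d k"
      unfolding ix using bnd d by (rule Tle)
    have t1: "T (forget_index (Suc n) m (x * Suc n + d) + m * Suc n - 1) \<le> k \<longleftrightarrow>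
        sols h r (l + m * (of_bool True + 2 * u)) (d - 1) k" if "0 < d"
      unfolding ix'[OF that] using d by (intro Tle bnd) simp
    have codeA: "code (map \<omega> (A @ r # B)) = l + m * (of_bool \<beta> + 2 * u) \<longleftrightarrow>
        code (map \<omega> A) = l \<and> \<omega> r = \<beta> \<and> code (map \<omega> B) = u" for \<omega> \<beta>
      using code_append_Cons_eq[of l "map \<omega> A" "\<omega> r" "map \<omega> B" \<beta> u] l by (simp add: m_def)
    have codeB: "code (map \<omega> (A @ B)) = l + m * u \<longleftrightarrow>
        code (map \<omega> A) = l \<and> code (map \<omega> B) = u" for \<omega>
      using code_append_eq[of l "map \<omega> A" "map \<omega> B" u] l by (simp add: m_def)
    have "forget_table (Suc n) m T (x * Suc n + d) \<le> k \<longleftrightarrow>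
       sols h r (l + m * (of_bool False + 2 * u)) d k \<or>
       0 < d \<and> sols h r (l + m * (of_bool True + 2 * u)) (d - 1) k"
      unfolding forget_table_def md t0[symmetric]
      using t1 by (cases "0 < d") (simp_all only: if_True if_False min_le_iff_disj simp_thms)
    also have "\<dots> \<longleftrightarrow> (\<exists>\<omega>. code (map \<omega> A) = l \<and> code (map \<omega> B) = u \<and>
        part h r \<omega> + of_bool (\<omega> r) = d \<and> good h \<omega> k)"
    proof -
      have split: "part h r \<omega> + of_bool (\<omega> r) = d \<longleftrightarrow>
          \<omega> r = False \<and> part h r \<omega> = d \<or> 0 < d \<and> \<omega> r = True \<and> part h r \<omega> = d - 1" for \<omega>
        by (cases "\<omega> r") auto
      show ?thesis unfolding sols_def q codeA split by auto
    qed
    also have "\<dots> \<longleftrightarrow> sols h (Suc r) x d k"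
      unfolding sols_def q part x_eq codeB by (simp add: conj_assoc)
    finally show ?thesis .
  qed
  then show "table h (Suc r) (forget_table (Suc n) (2 ^ length (kept h r)) T)"
    unfolding table_def A_def m_def by blast
qed

text \<open>The left end of \<open>r\<close> is the current vertex at \<open>h + 1\<close>, which is
  neither finished nor has counted \<open>r\<close>. Hence \<open>part h r\<close> and
  \<open>good h\<close> do not see \<open>\<omega> r\<close>, and a solution may be redefined at
  \<open>r\<close> to match the new bit.\<close>

lemma table_insert:
  assumes r: "r < n * n" and act: "\<not> active h r" "active (Suc h) r" and T: "table h r T"
  shows "table h (Suc r) (insert_table (Suc n) (2 ^ length (kept h r)) T)"
    and "length (queue h (Suc r)) = Suc (length (queue h r))"
proof -
  define A where "A = kept h r"
  define B where "B = filter (active h) [Suc r..<n * n]"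
  define m :: nat where "m = 2 ^ length A"
  have q: "queue h r = A @ B" "queue h (Suc r) = A @ r # B"
    using queue_Suc[OF r] act by (simp_all add: A_def B_def)
  then show "length (queue h (Suc r)) = Suc (length (queue h r))" by simp
  have rQ: "r \<in> Q" "a r = h + 1" "h + 2 < b r" using act by (auto simp: active_def)
  then have part: "part h (Suc r) \<omega> = part h r \<omega> + of_bool (\<not> \<omega> r)" for \<omega>
    by (simp add: part_Suc)
  have fresh: "r \<notin> set A" "r \<notin> set B" by (auto simp: A_def B_def)
  have part_upd: "part h r (\<omega>(r := \<beta>)) = part h r \<omega>" for \<omega> \<beta>
  proof -
    have "hp (\<omega>(r := \<beta>)) q = hp \<omega> q" if "q \<in> counted h r" for q
      using that rQ by (auto simp: counted_def hp_def)
    then have "{q \<in> counted h r. hp (\<omega>(r := \<beta>)) q \<in> {h+1, h+2}} =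
       {q \<in> counted h r. hp \<omega> q \<in> {h+1, h+2}}" by auto
    then show ?thesis by (simp add: part_def)
  qed
  have "indeg (\<omega>(r := \<beta>)) j = indeg \<omega> j" if "j \<le> h" for \<omega> \<beta> j
  proof -
    have "hp (\<omega>(r := \<beta>)) q = j \<longleftrightarrow> hp \<omega> q = j" for q
      using that rQ by (auto simp: hp_def)
    then show ?thesis by (simp add: indeg_def)
  qed
  then have good_upd: "good h (\<omega>(r := \<beta>)) k \<longleftrightarrow> good h \<omega> k" for \<omega> \<beta> k
    by (auto simp: good_def cong: conj_cong)
  have "insert_table (Suc n) m T (x * Suc n + d) \<le> k \<longleftrightarrow> sols h (Suc r) x d k"
    if x: "x < 2 ^ length (queue h (Suc r))" and d: "d \<le> n" and k: "k \<le> n" for x d k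
  proof -
    define l where "l = x mod m"
    define \<beta> where "\<beta> = odd (x div m)"
    define u where "u = x div m div 2"
    have l: "l < m" by (simp add: l_def m_def)
    have "x = l + m * (x div m)" by (simp add: l_def)
    also have "x div m = of_bool \<beta> + 2 * u"
      unfolding \<beta>_def u_def by (cases "even (x div m)") simp_all
    finally have x_eq: "x = l + m * (of_bool \<beta> + 2 * u)" .
    have "u < 2 ^ length B"
      using x by (simp add: q m_def u_def power_add less_mult_imp_div_less mult.commute)
    then have u: "u + 1 \<le> 2 ^ length B" by simp
    have bnd: "l + m * u < 2 ^ length (queue h r)"
    proof -
      have "l + m * u < m + m * u" using l by simp
      also have "\<dots> = m * (u + 1)" by (simp add: algebra_simps)
      also have "\<dots> \<le> m * 2 ^ length B" using u by (intro mult_le_mono) auto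
      also have "\<dots> = 2 ^ length (queue h r)" by (simp add: q m_def power_add)
      finally show ?thesis .
    qed
    have Tle: "T (y * Suc n + e) \<le> k \<longleftrightarrow> sols h r y e k"
      if "y < 2 ^ length (queue h r)" "e \<le> n" for y e
      using T k that unfolding table_def by blast
    note dv = index_div_mod(1)[OF d, of x] and md = index_div_mod(2)[OF d, of x]
    have ix: "insert_index (Suc n) m (x * Suc n + d) = (l + m * u) * Suc n + d"
      unfolding insert_index_def dv md by (simp add: l_def u_def algebra_simps div_mult2_eq)
    have ix': "insert_index (Suc n) m (x * Suc n + d) - 1 = (l + m * u) * Suc n + (d - 1)" if "0 < d"
      using that unfolding ix by simp
    have t0: "T (insert_index (Suc n) m (x * Suc n + d)) \<le> k \<longleftrightarrow> sols h r (l + m * u) d k"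
      unfolding ix using bnd d by (rule Tle)
    have t1: "T (insert_index (Suc n) m (x * Suc n + d) - 1) \<le> k \<longleftrightarrow> sols h r (l + m * u) (d - 1) k"
      if "0 < d"
      unfolding ix'[OF that] using bnd d by (intro Tle) auto
    have codeA: "code (map \<omega> (A @ r # B)) = l + m * (of_bool \<beta> + 2 * u) \<longleftrightarrow>
        code (map \<omega> A) = l \<and> \<omega> r = \<beta> \<and> code (map \<omega> B) = u" for \<omega>
      using code_append_Cons_eq[of l "map \<omega> A" "\<omega> r" "map \<omega> B" \<beta> u] l by (simp add: m_def)
    have codeB: "code (map \<omega> (A @ B)) = l + m * u \<longleftrightarrow>
        code (map \<omega> A) = l \<and> code (map \<omega> B) = u" for \<omega>
      using code_append_eq[of l "map \<omega> A" "map \<omega> B" u] l by (simp add: m_def)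
    \<comment> \<open>For bit 0 and count 0 the entry is \<open>Suc n\<close>, above every threshold
      \<open>k \<le> n\<close>; this matches the false right-hand side.\<close>
    have "insert_table (Suc n) m T (x * Suc n + d) \<le> k \<longleftrightarrow>
       (if \<beta> then sols h r (l + m * u) d k else 0 < d \<and> sols h r (l + m * u) (d - 1) k)"
      unfolding insert_table_def md dv \<beta>_def[symmetric] t0[symmetric]
      using t1 k by (cases "0 < d"; cases \<beta>) (simp_all only: if_True if_False simp_thms not_less_eq_eq[symmetric])
    also have "\<dots> \<longleftrightarrow> (\<exists>\<omega>. code (map \<omega> A) = l \<and> code (map \<omega> B) = u \<and>
        part h r \<omega> + of_bool (\<not> \<beta>) = d \<and> good h \<omega> k)"
    proof -
      have split: "part h r \<omega> + of_bool (\<not> \<beta>) = d \<longleftrightarrow>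
          (if \<beta> then part h r \<omega> = d else 0 < d \<and> part h r \<omega> = d - 1)" for \<omega>
        by auto
      show ?thesis unfolding sols_def q codeB split by (cases \<beta>) auto
    qed
    also have "\<dots> \<longleftrightarrow> (\<exists>\<omega>. code (map \<omega> A) = l \<and> \<omega> r = \<beta> \<and> code (map \<omega> B) = u \<and>
        part h r \<omega> + of_bool (\<not> \<omega> r) = d \<and> good h \<omega> k)" (is "(\<exists>\<omega>. ?L \<omega>) \<longleftrightarrow> (\<exists>\<omega>. ?R \<omega>)")
    proof
      assume "\<exists>\<omega>. ?L \<omega>"
      then obtain \<omega> where "?L \<omega>" by blast
      moreover have maps: "map (\<omega>(r := \<beta>)) A = map \<omega> A" "map (\<omega>(r := \<beta>)) B = map \<omega> B"
        using fresh by (auto simp: map_eq_conv)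
      ultimately have "?R (\<omega>(r := \<beta>))"
        unfolding maps part_upd good_upd by simp
      then show "\<exists>\<omega>. ?R \<omega>" by (rule exI[where x = "\<omega>(r := \<beta>)"])
    next
      assume "\<exists>\<omega>. ?R \<omega>"
      then obtain \<omega> where "?R \<omega>" by blast
      then have "?L \<omega>" by (cases \<beta>) auto
      then show "\<exists>\<omega>. ?L \<omega>" by (rule exI[where x = \<omega>])
    qed
    also have "\<dots> \<longleftrightarrow> sols h (Suc r) x d k"
      unfolding sols_def q part x_eq codeA by (simp add: conj_assoc)
    finally show ?thesis .
  qed
  then show "table h (Suc r) (insert_table (Suc n) (2 ^ length (kept h r)) T)"
    unfolding table_def A_def m_def by blast
qed

section \<open>Passing from one time to the next, with or without a vertex\<close>

lemma queue_next: "queue h (n * n) = queue (Suc h) 0"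
  by (simp add: queue_def)

text \<open>Going from an even to an odd time, the current vertex stays the same: it is at
  \<open>h + 2\<close>, which is also \<open>Suc h + 1\<close>. So the count, the finished vertices
  and the table carry over unchanged.\<close>

lemma table_next:
  assumes "table h (n * n) T" "Suc h \<le> 2 * n" "\<And>v. v < n \<Longrightarrow> pos v \<noteq> Suc h"
  shows "table (Suc h) 0 T"
proof -
  \<comment> \<open>Every even number from 2 to \<open>2 * n\<close> is the position of a vertex, so
    an empty position is odd.\<close>
  have odd: "odd (Suc h)"
  proof
    assume "even (Suc h)"
    then obtain i where "Suc h = 2 * i" by (elim evenE)
    then have "Suc h \<in> (\<lambda>i. 2 * i) ` {1..n}" using assms(2) by (intro image_eqI[of _ _ i]) auto
    then show False using assms(3) pos_image by (metis imageE lessThan_iff)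
  qed
  have ne: "a q \<noteq> Suc h" "b q \<noteq> Suc h" "a q \<noteq> h + 3" "b q \<noteq> h + 3" for q
    using odd even_a[of q] even_b[of q] by (metis even_Suc numeral_3_eq_3 add_Suc_right add_0_right)+
  have "{q \<in> counted h (n * n). hp \<omega> q \<in> {h + 1, h + 2}} =
      {q \<in> counted (Suc h) 0. hp \<omega> q \<in> {Suc h + 1, Suc h + 2}}" for \<omega>
    using ne by (auto simp: counted_def hp_def Q_less numeral_3_eq_3)
  then have "part h (n * n) \<omega> = part (Suc h) 0 \<omega>" for \<omega> by (simp add: part_def)
  moreover have "pos v \<le> Suc h \<longleftrightarrow> pos v \<le> h" if "v < n" for v
    using assms(3)[OF that] by (simp add: le_Suc_eq)
  then have "good h \<omega> k = good (Suc h) \<omega> k" for \<omega> k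
    by (simp add: good_def cong: conj_cong imp_cong)
  ultimately show ?thesis
    using assms(1) by (simp add: table_def sols_def queue_next)
qed

text \<open>At the end of an odd step every edge at the vertex has been counted, so the count equals
  its indegree; only now can the capacity be tested and the vertex be charged to the size.\<close>

lemma table_finish:
  assumes T: "table h (n * n) T" and v: "v < n" "pos v = Suc h"
    and deg: "\<And>\<omega>. indeg \<omega> (Suc h) \<le> n"
  shows "table (Suc h) 0 (finish_table (Suc n) (c v) T)"
proof -
  have ev: "even (Suc h)" using v pos_image by (metis dvd_triv_left imageE imageI lessThan_iff)
  have ne: "a q \<noteq> h + 2" "b q \<noteq> h + 2" for q
    using ev even_a[of q] even_b[of q] by auto
  have "{q \<in> counted h (n * n). hp \<omega> q \<in> {h + 1, h + 2}} = {q \<in> Q. hp \<omega> q = Suc h}" for \<omega>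
    using ne by (auto simp: counted_def hp_def Q_less)
  then have part: "part h (n * n) \<omega> = indeg \<omega> (Suc h)" for \<omega>
    by (simp add: part_def indeg_def)
  have "counted (Suc h) 0 = {}" using ev even_b by (auto simp: counted_def) (metis even_Suc)
  then have part0: "part (Suc h) 0 \<omega> = 0" for \<omega> by (simp add: part_def)
  have good: "good (Suc h) \<omega> k \<longleftrightarrow> indeg \<omega> (Suc h) \<le> c v \<and> of_bool (0 < indeg \<omega> (Suc h)) \<le> k \<and>
      good h \<omega> (k - of_bool (0 < indeg \<omega> (Suc h)))" for \<omega> k
  proof -
    have uniq: "u = v" if "u < n" "pos u = Suc h" for u
      using that v inj_onD[OF inj_pos, of u v] by simp
    have le: "pos u \<le> Suc h \<longleftrightarrow> pos u \<le> h \<or> u = v" if "u < n" for u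
      using uniq[OF that] v by (auto simp: le_Suc_eq)
    let ?S = "\<lambda>h. {u. u < n \<and> pos u \<le> h \<and> 0 < indeg \<omega> (pos u)}"
    have S: "?S (Suc h) = (if 0 < indeg \<omega> (Suc h) then insert v (?S h) else ?S h)"
    proof -
      have "?S (Suc h) = {u. u < n \<and> (pos u \<le> h \<or> u = v) \<and> 0 < indeg \<omega> (pos u)}"
        by (simp add: le cong: conj_cong)
      also have "\<dots> = ?S h \<union> {u. u = v \<and> 0 < indeg \<omega> (Suc h)}"
        using v by (intro set_eqI) (simp, metis)
      finally show ?thesis by simp
    qed
    have "card (?S (Suc h)) = card (?S h) + of_bool (0 < indeg \<omega> (Suc h))"
      unfolding S using v by simp
    moreover have "(\<forall>u<n. pos u \<le> Suc h \<longrightarrow> indeg \<omega> (pos u) \<le> c u) \<longleftrightarrow>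
       (\<forall>u<n. pos u \<le> h \<longrightarrow> indeg \<omega> (pos u) \<le> c u) \<and> indeg \<omega> (Suc h) \<le> c v"
      using le v by auto
    ultimately show ?thesis unfolding good_def by (cases "0 < indeg \<omega> (Suc h)") auto
  qed
  have "finish_table (Suc n) (c v) T (x * Suc n + d) \<le> k \<longleftrightarrow> sols (Suc h) 0 x d k"
    if x: "x < 2 ^ length (queue (Suc h) 0)" and d: "d \<le> n" and k: "k \<le> n" for x d k
  proof (cases "d = 0")
    case False
    then show ?thesis using k index_div_mod(2)[OF d, of x] by (simp add: finish_table_def sols_def part0)
  next
    case True
    have "finish_table (Suc n) (c v) T (x * Suc n + d) \<le> k \<longleftrightarrow>
      (\<exists>e\<le>n. e \<le> c v \<and> T (x * Suc n + e) + of_bool (0 < e) \<le> k)"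
      using True by (simp add: finish_table_def best_le_iff del: mult_Suc_right)
    \<comment> \<open>The natural-number subtraction is guarded by
      \<open>of_bool (0 < e) \<le> k\<close>.\<close>
    also have "\<dots> \<longleftrightarrow> (\<exists>e\<le>n. e \<le> c v \<and> of_bool (0 < e) \<le> k \<and> T (x * Suc n + e) \<le> k - of_bool (0 < e))"
      by (intro ex_cong1) auto
    also have "\<dots> \<longleftrightarrow> (\<exists>e\<le>n. e \<le> c v \<and> of_bool (0 < e) \<le> k \<and> sols h (n * n) x e (k - of_bool (0 < e)))"
      using T x k unfolding table_def queue_next
      by (intro ex_cong1) (metis (no_types, lifting) diff_le_self le_trans)
    \<comment> \<open>The witness for \<open>e\<close> is the indegree under
      \<open>\<omega>\<close>, and \<open>deg\<close> places it in the range of stored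
      counts.\<close>
    also have "\<dots> \<longleftrightarrow> sols (Suc h) 0 x d k"
      unfolding sols_def part part0 good queue_next True simp_thms using deg by blast
    finally show ?thesis .
  qed
  then show ?thesis unfolding table_def by blast
qed

section \<open>The two ends of the sweep\<close>

lemma queue_start: "queue 0 0 = []"
  using a_pos by (auto simp: queue_def active_def filter_empty_conv)

lemma queue_stop: "queue (2 * n) 0 = []"
  using b_le by (fastforce simp: queue_def active_def filter_empty_conv)

lemma table_init: "table 0 0 (init_table (Suc n))"
proof -
  have "counted 0 0 = {}" using even_b by (auto simp: counted_def) (metis odd_one One_nat_def)
  then have p: "part 0 0 \<omega> = 0" for \<omega> by (simp add: part_def)
  have "0 < pos v" if "v < n" for v
    using that pos_image by (metis atLeastAtMost_iff imageE imageI lessThan_iff mult_is_0 not_gr_zero not_one_le_zero zero_neq_numeral)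
  then have "\<not> (v < n \<and> pos v \<le> 0)" for v by (metis less_nat_zero_code le_zero_eq)
  then have "good 0 \<omega> k" for \<omega> k unfolding good_def
    by (metis (no_types, lifting) Collect_empty_eq card.empty le0)
  then show ?thesis unfolding table_def sols_def queue_start p by (auto simp: init_table_def)
qed

lemma table_final:
  assumes "table (2 * n) 0 T" "k \<le> n"
  shows "T 0 \<le> k \<longleftrightarrow> (\<exists>\<omega>. good (2 * n) \<omega> k)"
proof -
  have "counted (2 * n) 0 = {}" using even_b by (auto simp: counted_def) (metis even_Suc dvd_triv_left)
  then have p: "part (2 * n) 0 \<omega> = 0" for \<omega> by (simp add: part_def)
  show ?thesis using assms unfolding table_def sols_def queue_stop p by (force dest: spec[of _ 0])
qed

end

section \<open>Orientations of an arranged graph\<close>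

locale arranged_graph =
  fixes n :: nat and E :: "nat set set" and c \<pi> :: "nat \<Rightarrow> nat"
  assumes graph: "simple_graph {..<n} E" and arr: "linear_arrangement {..<n} \<pi>"
begin

text \<open>The edge with left end \<open>u\<close> and right end \<open>v\<close> has the number \<open>u * n + v\<close>.\<close>

definition Q :: "nat set" where
  "Q = {q. q < n * n \<and> {q div n, q mod n} \<in> E \<and> \<pi> (q div n) < \<pi> (q mod n)}"

abbreviation (input) a :: "nat \<Rightarrow> nat" where "a q \<equiv> 2 * \<pi> (q div n)"
abbreviation (input) b :: "nat \<Rightarrow> nat" where "b q \<equiv> 2 * \<pi> (q mod n)"
abbreviation (input) pos :: "nat \<Rightarrow> nat" where "pos v \<equiv> 2 * \<pi> v"

lemma bij_pi: "bij_betw \<pi> {..<n} {1..n}"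
  using arr by (simp add: linear_arrangement_def)

lemma inj_pi: "\<lbrakk>u < n; v < n; \<pi> u = \<pi> v\<rbrakk> \<Longrightarrow> u = v"
  using bij_pi by (auto simp: bij_betw_def dest: inj_onD)

lemma pi_bounds: "v < n \<Longrightarrow> 1 \<le> \<pi> v \<and> \<pi> v \<le> n"
  using bij_betwE[OF bij_pi] by auto

lemma edge_ends:
  assumes "q < n * n"
  shows "q div n < n" "q mod n < n"
proof -
  have "0 < n" using assms by (cases n) auto
  then show "q div n < n" "q mod n < n" using assms by (simp_all add: less_mult_imp_div_less)
qed

lemma edge_index:
  assumes "u < n" "v < n"
  shows "u * n + v < n * n" "(u * n + v) div n = u" "(u * n + v) mod n = v"
proof -
  have "u * n + v < (u + 1) * n" using assms by simp
  also have "\<dots> \<le> n * n" using assms by (intro mult_le_mono1) simp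
  finally show "u * n + v < n * n" .
qed (use assms in simp_all)

lemma edge_vertices:
  assumes "{u, v} \<in> E"
  shows "u < n" "v < n" "u \<noteq> v" "\<pi> u \<noteq> \<pi> v"
proof -
  show "u < n" "v < n" "u \<noteq> v" using assms graph by (auto simp: simple_graph_def)
  then show "\<pi> u \<noteq> \<pi> v" using inj_pi by blast
qed

lemma finite_E: "finite E"
  by (rule finite_subset[of _ "Pow {..<n}"]) (use graph in \<open>auto simp: simple_graph_def\<close>)

sublocale sweep n Q a b pos c
proof
  show "inj_on (\<lambda>v. 2 * \<pi> v) {..<n}" by (auto intro!: inj_onI dest: inj_pi)
  have "(\<lambda>v. 2 * \<pi> v) ` {..<n} = (\<lambda>i. 2 * i) ` (\<pi> ` {..<n})" by (simp add: image_image)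
  then show "(\<lambda>v. 2 * \<pi> v) ` {..<n} = (\<lambda>i. 2 * i) ` {1..n}"
    using bij_pi by (simp add: bij_betw_def)
qed (use pi_bounds edge_ends in \<open>force simp: Q_def\<close>)+

section \<open>Bit functions on edge numbers correspond to orientations\<close>

definition head :: "(nat \<Rightarrow> bool) \<Rightarrow> nat \<Rightarrow> nat" where
  "head \<omega> q = (if \<omega> q then q mod n else q div n)"

definition tail :: "(nat \<Rightarrow> bool) \<Rightarrow> nat \<Rightarrow> nat" where
  "tail \<omega> q = (if \<omega> q then q div n else q mod n)"

definition arcs :: "(nat \<Rightarrow> bool) \<Rightarrow> (nat \<times> nat) set" where
  "arcs \<omega> = (\<lambda>q. (tail \<omega> q, head \<omega> q)) ` Q"

lemma hp_eq_pos:
  assumes "q \<in> Q" "v < n"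
  shows "hp \<omega> q = pos v \<longleftrightarrow> head \<omega> q = v"
proof -
  have "q div n < n" "q mod n < n" using assms(1) edge_ends by (auto simp: Q_def)
  then show ?thesis using assms inj_pi by (auto simp: hp_def head_def)
qed

text \<open>The strict order of the ends in \<open>Q\<close> excludes the number with swapped
  ends.\<close>

lemma ends_unique:
  assumes "q \<in> Q" "q' \<in> Q" "{q div n, q mod n} = {q' div n, q' mod n}"
  shows "q = q'"
proof -
  have "q div n = q' div n \<and> q mod n = q' mod n"
    using assms by (auto simp: Q_def doubleton_eq_iff)
  then show ?thesis by (metis div_mult_mod_eq)
qed

lemma indegree_arcs:
  assumes "v < n"
  shows "indegree (arcs \<omega>) v = indeg \<omega> (pos v)"
proof -
  have "{u. (u, v) \<in> arcs \<omega>} = tail \<omega> ` {q \<in> Q. hp \<omega> q = pos v}"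
    using hp_eq_pos[OF _ assms] by (auto simp: arcs_def)
  moreover have "inj_on (tail \<omega>) {q \<in> Q. hp \<omega> q = pos v}"
  proof (rule inj_onI)
    fix q q'
    assume *: "q \<in> {q \<in> Q. hp \<omega> q = pos v}" "q' \<in> {q \<in> Q. hp \<omega> q = pos v}"
      and t: "tail \<omega> q = tail \<omega> q'"
    then have "head \<omega> q = v" "head \<omega> q' = v" using hp_eq_pos[OF _ assms] by auto
    then have "{q div n, q mod n} = {q' div n, q' mod n}"
      using t by (auto simp: head_def tail_def split: if_splits)
    then show "q = q'" using ends_unique * by blast
  qed
  ultimately show ?thesis by (simp add: indegree_def indeg_def card_image)
qed

text \<open>Every edge has exactly one number in \<open>Q\<close>, hence yields exactly one
  arc.\<close>

lemma orientation_arcs: "orientation E (arcs \<omega>)"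
  unfolding orientation_def
proof (intro conjI allI impI)
  show "{u, v} \<in> E" if "(u, v) \<in> arcs \<omega>" for u v
    using that by (auto simp: arcs_def head_def tail_def Q_def insert_commute split: if_splits)
  have index: "\<exists>q\<in>Q. q div n = u \<and> q mod n = v" if "{u, v} \<in> E" "\<pi> u < \<pi> v" for u v
    using that edge_index[of u v] edge_vertices[of u v]
    by (intro bexI[of _ "u * n + v"]) (auto simp: Q_def)
  have arc: "(u, v) \<in> arcs \<omega> \<longleftrightarrow> \<omega> q" "(v, u) \<in> arcs \<omega> \<longleftrightarrow> \<not> \<omega> q"
    if q: "q \<in> Q" "q div n = u" "q mod n = v" for u v q
  proof -
    have "u \<noteq> v" using that by (auto simp: Q_def)
    have only: "(x, y) \<in> arcs \<omega> \<longleftrightarrow> x = tail \<omega> q \<and> y = head \<omega> q" if xy: "{x, y} = {u, v}" for x y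
    proof
      assume "(x, y) \<in> arcs \<omega>"
      then obtain q' where q': "q' \<in> Q" "x = tail \<omega> q'" "y = head \<omega> q'" by (auto simp: arcs_def)
      then have "{q' div n, q' mod n} = {x, y}" by (auto simp: head_def tail_def)
      then have "q' = q" using ends_unique[OF q'(1) \<open>q \<in> Q\<close>] xy q by simp
      with q' show "x = tail \<omega> q \<and> y = head \<omega> q" by simp
    qed (use q in \<open>auto simp: arcs_def\<close>)
    show "(u, v) \<in> arcs \<omega> \<longleftrightarrow> \<omega> q" "(v, u) \<in> arcs \<omega> \<longleftrightarrow> \<not> \<omega> q"
      using q \<open>u \<noteq> v\<close> by (simp_all add: only insert_commute head_def tail_def)
  qed
  show "(u, v) \<in> arcs \<omega> \<longleftrightarrow> (v, u) \<notin> arcs \<omega>" if "{u, v} \<in> E" for u v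
  proof (cases "\<pi> u < \<pi> v")
    case True
    with index[OF that] arc show ?thesis by blast
  next
    case False
    then have "\<pi> v < \<pi> u" using edge_vertices(4)[OF that] by simp
    moreover have "{v, u} \<in> E" using that by (simp add: insert_commute)
    ultimately show ?thesis using index[of v u] arc by blast
  qed
qed

lemma orientation_is_arcs:
  assumes "orientation E D"
  shows "\<exists>\<omega>. D = arcs \<omega>"
proof
  let ?\<omega> = "\<lambda>q. (q div n, q mod n) \<in> D"
  have D: "{u, v} \<in> E" if "(u, v) \<in> D" for u v using assms that by (auto simp: orientation_def)
  have anti: "(u, v) \<in> D \<longleftrightarrow> (v, u) \<notin> D" if "{u, v} \<in> E" for u v
    using assms that by (auto simp: orientation_def)
  show "D = arcs ?\<omega>"
  proof (intro equalityI subrelI)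
    fix u v
    assume uv: "(u, v) \<in> D"
    note vs = edge_vertices[OF D[OF uv]] and e = edge_index[of u v] edge_index[of v u]
    show "(u, v) \<in> arcs ?\<omega>"
    proof (cases "\<pi> u < \<pi> v")
      case True
      then have "u * n + v \<in> Q" using vs e D[OF uv] by (simp add: Q_def)
      then show ?thesis unfolding arcs_def
        by (rule rev_image_eqI) (use vs e uv in \<open>simp add: head_def tail_def\<close>)
    next
      case False
      then have "v * n + u \<in> Q" using vs e D[OF uv] by (simp add: Q_def insert_commute)
      then show ?thesis unfolding arcs_def
        by (rule rev_image_eqI) (use vs e uv anti[OF D[OF uv]] in \<open>simp add: head_def tail_def\<close>)
    qed
  next
    fix u v
    assume "(u, v) \<in> arcs ?\<omega>"
    then obtain q where "q \<in> Q" "u = tail ?\<omega> q" "v = head ?\<omega> q" by (auto simp: arcs_def)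
    then show "(u, v) \<in> D" using anti[of "q div n" "q mod n"]
      by (auto simp: Q_def head_def tail_def split: if_splits)
  qed
qed

text \<open>At time \<open>2 * n\<close> all vertices are finished, so \<open>good\<close> tests
  every capacity and counts every vertex of positive indegree.\<close>

lemma feasible_iff_good:
  "(\<exists>D. feasible_orientation {..<n} E c D \<and> orientation_size {..<n} D \<le> k) \<longleftrightarrow>
   (\<exists>\<omega>. good (2 * n) \<omega> k)"
proof -
  have "good (2 * n) \<omega> k \<longleftrightarrow>
      feasible_orientation {..<n} E c (arcs \<omega>) \<and> orientation_size {..<n} (arcs \<omega>) \<le> k" for \<omega>
  proof -
    have "{v. v < n \<and> pos v \<le> 2 * n \<and> 0 < indeg \<omega> (pos v)} =
        {v \<in> {..<n}. 0 < indegree (arcs \<omega>) v}"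
      using pi_bounds indegree_arcs by auto
    then show ?thesis using pi_bounds indegree_arcs orientation_arcs
      by (auto simp: good_def feasible_orientation_def orientation_size_def)
  qed
  then show ?thesis using orientation_is_arcs by (metis feasible_orientation_def)
qed

lemma orientation_size_le: "orientation_size {..<n} D \<le> n"
  unfolding orientation_size_def by (rule order_trans[OF card_mono[of "{..<n}"]]) auto

text \<open>No size exceeds \<open>n\<close>, so the threshold \<open>n\<close> decides feasibility
  and the smaller ones determine the minimum; a value above \<open>n\<close> is read as
  infinity.\<close>

lemma min_orientation_size_eq:
  assumes T: "\<And>k. k \<le> n \<Longrightarrow> m \<le> k \<longleftrightarrow> (\<exists>\<omega>. good (2 * n) \<omega> k)"
  shows "min_orientation_size {..<n} E c = (if m \<le> n then Some m else None)"
proof -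
  let ?F = "feasible_orientation {..<n} E c" and ?size = "orientation_size {..<n}"
  have *: "m \<le> k \<longleftrightarrow> (\<exists>D. ?F D \<and> ?size D \<le> k)" if "k \<le> n" for k
    using T[OF that] feasible_iff_good by simp
  have "(\<exists>D. ?F D) \<longleftrightarrow> m \<le> n" using *[of n] orientation_size_le by auto
  moreover have "(LEAST k. \<exists>D. ?F D \<and> ?size D = k) = m" if m: "m \<le> n"
  proof -
    have lower: "m \<le> ?size D" if "?F D" for D
      using *[OF orientation_size_le, of D] that by blast
    obtain D where "?F D" "?size D \<le> m" using *[OF m] by blast
    with lower have "?size D = m" by (simp add: eq_iff)
    then show ?thesis using \<open>?F D\<close> lower by (intro Least_equality) auto
  qed
  ultimately show ?thesis by (simp add: min_orientation_size_def)
qed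

text \<open>In-neighbours are distinct vertices, so counts up to \<open>n\<close> suffice and a
  table row needs only \<open>n + 1\<close> entries.\<close>

lemma indeg_le: "v < n \<Longrightarrow> indeg \<omega> (pos v) \<le> n"
proof -
  assume v: "v < n"
  have "{u. (u, v) \<in> arcs \<omega>} \<subseteq> {..<n}"
    using orientation_arcs[of \<omega>] edge_vertices(1) unfolding orientation_def by blast
  then have "indegree (arcs \<omega>) v \<le> n"
    unfolding indegree_def by (metis card_lessThan card_mono finite_lessThan)
  then show ?thesis using indegree_arcs[OF v] by simp
qed

text \<open>Source of the exponent. Throughout one half step, old and new edges of the mixed queue
  all belong to the same cut: number \<open>h div 2\<close> while forgetting,
  \<open>(h + 1) div 2\<close> while inserting. Both are \<open>Suc h div 2\<close>.\<close>

lemma length_queue_le: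
  assumes "h < 2 * n" "r \<le> n * n"
  shows "length (queue h r) \<le> cutwidth {..<n} E \<pi>"
proof -
  define i where "i = Suc h div 2"
  have i: "i \<le> n" using assms by (simp add: i_def)
  have act: "\<pi> (q div n) \<le> i \<and> i < \<pi> (q mod n)" if "active h q \<or> active (Suc h) q" for q
    using that by (auto simp: active_def i_def)
  have dist: "distinct (queue h r)" using assms(2) by (auto simp: queue_def)
  have sub: "set (queue h r) \<subseteq> {q \<in> Q. \<pi> (q div n) \<le> i \<and> i < \<pi> (q mod n)}" (is "_ \<subseteq> ?S")
    using act by (fastforce simp: queue_def active_def)
  have "length (queue h r) = card (set (queue h r))" using dist by (simp add: distinct_card)
  also have "\<dots> \<le> card ?S" using sub finite_Q by (intro card_mono) auto
  also have "\<dots> = card ((\<lambda>q. {q div n, q mod n}) ` ?S)"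
    by (rule card_image[symmetric]) (use ends_unique in \<open>auto intro!: inj_onI\<close>)
  also have "\<dots> \<le> card (cut_edges E \<pi> i)"
    using finite_E by (intro card_mono) (auto simp: cut_edges_def Q_def)
  also have "\<dots> \<le> cutwidth {..<n} E \<pi>"
    unfolding cutwidth_def using i by (intro Max_ge) auto
  finally show ?thesis .
qed

end

section \<open>Running programs\<close>

text \<open>Weakest precondition for halting runs whose postcondition also receives the time. The
  equations below let the simplifier execute loop-free code, leaving the \<open>fits\<close>
  conditions as side goals.\<close>

definition runs :: "nat \<Rightarrow> prog \<Rightarrow> state \<Rightarrow> (nat \<Rightarrow> state \<Rightarrow> bool) \<Rightarrow> bool" where
  "runs w P s R \<longleftrightarrow> (\<exists>t s'. exec w P s t s' \<and> R t s')"

lemma runs_weaken: "runs w P s R \<Longrightarrow> (\<And>t s'. R t s' \<Longrightarrow> R' t s') \<Longrightarrow> runs w P s R'"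
  by (auto simp: runs_def)

lemma runs_Skip [simp]: "runs w Skip s R \<longleftrightarrow> R 1 s"
  unfolding runs_def by (metis exec.Skip exec_SkipE)

lemma runs_Assign [simp]:
  "runs w (Assign x a) s R \<longleftrightarrow>
     fits w a s \<and> R (1 + expr_cost a) (s\<lparr>regs := (regs s)(x := eval_expr a s)\<rparr>)"
  unfolding runs_def by (metis exec.Assign exec_AssignE)

lemma runs_Store [simp]:
  "runs w (Store a b) s R \<longleftrightarrow>
     fits w a s \<and> fits w b s \<and> R (1 + expr_cost a + expr_cost b)
      (s\<lparr>mem := (mem s)(eval_expr a s := eval_expr b s)\<rparr>)"
  unfolding runs_def by (metis exec.Store exec_StoreE)

lemma runs_Seq [simp]:
  "runs w (Seq P Q) s R \<longleftrightarrow> runs w P s (\<lambda>t s'. runs w Q s' (\<lambda>t' s''. R (t + t') s''))"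
  unfolding runs_def by (blast intro: exec.Seq elim: exec_SeqE)

lemma runs_If [simp]:
  "runs w (If a P Q) s R \<longleftrightarrow> fits w a s \<and>
     (if eval_expr a s \<noteq> 0 then runs w P s (\<lambda>t. R (1 + expr_cost a + t))
      else runs w Q s (\<lambda>t. R (1 + expr_cost a + t)))"
proof -
  have 0: "exec w (If a P Q) s t s' \<longleftrightarrow>
      (\<exists>u. fits w a s \<and> exec w Q s u s' \<and> t = 1 + expr_cost a + u)"
    if "eval_expr a s = 0" for t s'
    by (rule iffI, erule exec_IfE, use that exec.IfFalse[OF _ that] in auto)
  have 1: "exec w (If a P Q) s t s' \<longleftrightarrow>
      (\<exists>u. fits w a s \<and> exec w P s u s' \<and> t = 1 + expr_cost a + u)"
    if "eval_expr a s \<noteq> 0" for t s'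
    by (rule iffI, erule exec_IfE, use that exec.IfTrue[OF _ that] in auto)
  show ?thesis
    by (cases "eval_expr a s = 0") (auto simp: runs_def 0 1)
qed

text \<open>All loops of the program have a number of rounds known in advance, so an invariant
  indexed by the round yields termination and the time bound together.\<close>

lemma runs_While_counter:
  assumes step: "\<And>j s. j < m \<Longrightarrow> I j s \<Longrightarrow>
      fits w a s \<and> eval_expr a s \<noteq> 0 \<and> runs w P s (\<lambda>t s'. t \<le> tb \<and> I (Suc j) s')"
    and stop: "\<And>s. I m s \<Longrightarrow> fits w a s \<and> eval_expr a s = 0"
    and start: "I 0 s"
  shows "runs w (While a P) s
    (\<lambda>t s'. t \<le> m * (tb + 1 + expr_cost a) + 1 + expr_cost a \<and> I m s')"
proof -
  \<comment> \<open>Generalised for the induction: \<open>k\<close> is the number of rounds still to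
    come.\<close>
  have "runs w (While a P) s
      (\<lambda>t s'. t \<le> k * (tb + 1 + expr_cost a) + 1 + expr_cost a \<and> I m s')"
    if "k \<le> m" "I (m - k) s" for k s
    using that
  proof (induction k arbitrary: s)
    case 0
    then show ?case using stop[of s] exec.WhileFalse[of w a s P] by (force simp: runs_def)
  next
    case (Suc k)
    then have "fits w a s" "eval_expr a s \<noteq> 0"
      "runs w P s (\<lambda>t s'. t \<le> tb \<and> I (Suc (m - Suc k)) s')"
      using step[of "m - Suc k" s] by auto
    moreover have "Suc (m - Suc k) = m - k" using Suc.prems(1) by simp
    ultimately obtain t s' where t: "exec w P s t s'" "t \<le> tb" "I (m - k) s'"
      by (auto simp: runs_def)
    with Suc.IH[of s'] Suc.prems(1) obtain t' s'' where
      t': "exec w (While a P) s' t' s''" "t' \<le> k * (tb + 1 + expr_cost a) + 1 + expr_cost a" "I m s''"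
      by (auto simp: runs_def)
    have "exec w (While a P) s (1 + expr_cost a + t + t') s''"
      by (rule exec.WhileTrue) fact+
    then show ?case unfolding runs_def using t(2) t'(2,3) by (intro exI conjI) auto
  qed
  from this[of m s] start show ?thesis by simp
qed

section \<open>The program\<close>

abbreviation plus_e :: "expr \<Rightarrow> expr \<Rightarrow> expr" (infixl "+\<^sub>e" 65) where "a +\<^sub>e b \<equiv> Bin Add a b"
abbreviation minus_e :: "expr \<Rightarrow> expr \<Rightarrow> expr" (infixl "-\<^sub>e" 65) where "a -\<^sub>e b \<equiv> Bin Sub a b"
abbreviation times_e :: "expr \<Rightarrow> expr \<Rightarrow> expr" (infixl "*\<^sub>e" 70) where "a *\<^sub>e b \<equiv> Bin Mul a b"
abbreviation div_e :: "expr \<Rightarrow> expr \<Rightarrow> expr" (infixl "div\<^sub>e" 70) where "a div\<^sub>e b \<equiv> Bin Div a b"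
abbreviation mod_e :: "expr \<Rightarrow> expr \<Rightarrow> expr" (infixl "mod\<^sub>e" 70) where "a mod\<^sub>e b \<equiv> Bin Mod a b"
abbreviation less_e :: "expr \<Rightarrow> expr \<Rightarrow> expr" (infix "<\<^sub>e" 50) where "a <\<^sub>e b \<equiv> Bin Less a b"
abbreviation seq_prog :: "prog \<Rightarrow> prog \<Rightarrow> prog" (infixr ";;" 55) where "P ;; Q \<equiv> Seq P Q"

abbreviation "rM \<equiv> Reg ''M''"
abbreviation "rN \<equiv> Reg ''N''"
abbreviation "rB \<equiv> Reg ''B''"
abbreviation "rcur \<equiv> Reg ''c''"
abbreviation "rp \<equiv> Reg ''p''"
abbreviation "ry \<equiv> Reg ''y''"
abbreviation "rr \<equiv> Reg ''r''"
abbreviation "rz \<equiv> Reg ''z''"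
abbreviation "rd \<equiv> Reg ''d''"

text \<open>
  The current table and the next one are interleaved from address \<open>B\<close> on, the first one after
  the input; the bit in register \<open>c\<close> selects the current one. Hence no bound on the size of the
  tables is needed. Register \<open>M\<close> holds the number of bit vectors and \<open>p\<close> is \<open>2\<close> to the
  position in the queue that is treated next.
\<close>

definition entry :: "expr \<Rightarrow> expr" where
  "entry e = Load (rB +\<^sub>e (Lit 2 *\<^sub>e e +\<^sub>e rcur))"

definition table_op :: "prog \<Rightarrow> prog" where
  "table_op body =
     Assign ''y'' (Lit 0) ;;
     While (ry <\<^sub>e rM *\<^sub>e rN)
       (body ;;
        Store (rB +\<^sub>e (Lit 2 *\<^sub>e ry +\<^sub>e (Lit 1 -\<^sub>e rcur))) rr ;;
        Assign ''y'' (ry +\<^sub>e Lit 1)) ;;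
     Assign ''c'' (Lit 1 -\<^sub>e rcur)"

definition init_body :: prog where
  "init_body = If ry (Assign ''r'' rN) (Assign ''r'' (Lit 0))"

definition forget_body :: prog where
  "forget_body =
     Assign ''z'' ((ry div\<^sub>e rN div\<^sub>e rp *\<^sub>e (Lit 2 *\<^sub>e rp) +\<^sub>e ry div\<^sub>e rN mod\<^sub>e rp) *\<^sub>e rN +\<^sub>e ry mod\<^sub>e rN) ;;
     Assign ''r'' (entry rz) ;;
     If (ry mod\<^sub>e rN)
       (Assign ''z'' (rz +\<^sub>e rp *\<^sub>e rN -\<^sub>e Lit 1) ;;
        If (entry rz <\<^sub>e rr) (Assign ''r'' (entry rz)) Skip)
       Skip"

definition insert_body :: prog where
  "insert_body =
     Assign ''z'' ((ry div\<^sub>e rN div\<^sub>e (Lit 2 *\<^sub>e rp) *\<^sub>e rp +\<^sub>e ry div\<^sub>e rN mod\<^sub>e rp) *\<^sub>e rN +\<^sub>e ry mod\<^sub>e rN) ;;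
     If (ry div\<^sub>e rN div\<^sub>e rp mod\<^sub>e Lit 2)
       (Assign ''r'' (entry rz))
       (If (ry mod\<^sub>e rN) (Assign ''r'' (entry (rz -\<^sub>e Lit 1))) (Assign ''r'' rN))"

definition finish_body :: "expr \<Rightarrow> prog" where
  "finish_body cap =
     If (ry mod\<^sub>e rN) (Assign ''r'' rN)
       (Assign ''r'' (entry ry) ;;
        Assign ''d'' (Lit 1) ;;
        While (rd <\<^sub>e rN)
          (If (cap <\<^sub>e rd) Skip
             (Assign ''z'' (entry (ry +\<^sub>e rd) +\<^sub>e Lit 1) ;;
              If (rz <\<^sub>e rr) (Assign ''r'' rz) Skip) ;;
           Assign ''d'' (rd +\<^sub>e Lit 1)))"

abbreviation "rn \<equiv> Reg ''n''"
abbreviation "rh \<equiv> Reg ''h''"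
abbreviation "rq \<equiv> Reg ''q''"
abbreviation "rv \<equiv> Reg ''v''"
abbreviation "ra \<equiv> Reg ''a''"
abbreviation "rb \<equiv> Reg ''b''"

definition position :: "expr \<Rightarrow> expr" where
  "position v = Lit 2 *\<^sub>e Load (Lit 1 +\<^sub>e (rn +\<^sub>e v))"

text \<open>Products serve as conjunctions, and strict comparison with \<open>h + 1\<close>
  expresses \<open>a \<le> h\<close>. \<open>M\<close> is set first because it is the size of the
  table to be written. \<open>p\<close> stays when a bit disappears, since the next bit moves to its
  place, and doubles only after an insertion, which itself needs the position of the new
  bit.\<close>

definition update :: prog where
  "update =
     If ((ra <\<^sub>e rh +\<^sub>e Lit 1) *\<^sub>e (rh +\<^sub>e Lit 1 <\<^sub>e rb))
       (If (rh +\<^sub>e Lit 2 <\<^sub>e rb)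
          (Assign ''p'' (Lit 2 *\<^sub>e rp))
          (Assign ''M'' (rM div\<^sub>e Lit 2) ;; table_op forget_body))
       (If ((ra <\<^sub>e rh +\<^sub>e Lit 2) *\<^sub>e (rh +\<^sub>e Lit 2 <\<^sub>e rb))
          (Assign ''M'' (Lit 2 *\<^sub>e rM) ;; table_op insert_body ;; Assign ''p'' (Lit 2 *\<^sub>e rp))
          Skip)"

definition scan :: prog where
  "scan =
     If (Load (Lit 1 +\<^sub>e (Lit 2 *\<^sub>e rn +\<^sub>e rq)))
       (Assign ''a'' (position (rq div\<^sub>e rn)) ;; Assign ''b'' (position (rq mod\<^sub>e rn)) ;; update)
       Skip ;;
     Assign ''q'' (rq +\<^sub>e Lit 1)"

text \<open>All vertices are tried, since the arrangement is stored by vertex; none matches when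
  \<open>h + 1\<close> is odd.\<close>

definition finish :: prog where
  "finish =
     If (Bin Equal (position rv) (rh +\<^sub>e Lit 1)) (table_op (finish_body (Load (Lit 1 +\<^sub>e rv)))) Skip ;;
     Assign ''v'' (rv +\<^sub>e Lit 1)"

definition sweep_round :: prog where
  "sweep_round =
     Assign ''q'' (Lit 0) ;; Assign ''p'' (Lit 1) ;;
     While (rq <\<^sub>e rn *\<^sub>e rn) scan ;;
     Assign ''v'' (Lit 0) ;;
     While (rv <\<^sub>e rn) finish ;;
     Assign ''h'' (rh +\<^sub>e Lit 1)"

text \<open>The tables start at \<open>N * N\<close> because the input fills
  \<open>1 + 2 * n + n * n = (n + 1) ^ 2\<close> cells. The registers \<open>h\<close> and
  \<open>c\<close> are 0 initially, like all registers.\<close>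

definition min_orientation_prog :: prog where
  "min_orientation_prog =
     Assign ''n'' (Load (Lit 0)) ;; Assign ''N'' (rn +\<^sub>e Lit 1) ;; Assign ''B'' (rN *\<^sub>e rN) ;;
     Assign ''M'' (Lit 1) ;; table_op init_body ;;
     While (rh <\<^sub>e Lit 2 *\<^sub>e rn) sweep_round ;;
     Assign ''size'' (entry (Lit 0)) ;; Assign ''feasible'' (Reg ''size'' <\<^sub>e rN)"

section \<open>Correctness of the table operations\<close>

text \<open>\<open>X\<close> bounds the number of bit vectors. The interleaved tables end before
  \<open>BB + 2 * (X * N)\<close>; the rest of the bound is slack for index arithmetic.\<close>

locale ram =
  fixes w N BB X :: nat
  assumes N_pos: "0 < N" and X_pos: "0 < X" and word: "BB + 4 * (X * N) + 4 < 2 ^ w"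
begin

text \<open>Invariant inside one table operation: half of the table area, the one selected by
  \<open>c\<close>, is protected, while the other half is being overwritten.\<close>

definition agree :: "state \<Rightarrow> state \<Rightarrow> bool" where
  "agree s s' \<longleftrightarrow>
     (\<forall>x. x \<notin> {''y'', ''r'', ''z'', ''d''} \<longrightarrow> regs s' x = regs s x) \<and>
     (\<forall>a<BB. mem s' a = mem s a) \<and>
     (\<forall>i. mem s' (BB + (2 * i + regs s ''c'')) = mem s (BB + (2 * i + regs s ''c'')))"

definition static :: "state \<Rightarrow> bool" where
  "static s \<longleftrightarrow> regs s ''N'' = N \<and> regs s ''B'' = BB \<and> regs s ''c'' \<le> 1"

text \<open>The cap \<open>N\<close> is demanded at every index, so \<open>table_bounds\<close>
  passes it on without regard to the table size.\<close>

definition holds :: "state \<Rightarrow> (nat \<Rightarrow> nat) \<Rightarrow> nat \<Rightarrow> bool" where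
  "holds s T m \<longleftrightarrow>
     (\<forall>i<m. mem s (BB + (2 * i + regs s ''c'')) = T i) \<and> (\<forall>i. T i \<le> N)"

definition frame :: "state \<Rightarrow> state \<Rightarrow> bool" where
  "frame s s' \<longleftrightarrow>
     (\<forall>x. x \<notin> {''y'', ''r'', ''z'', ''d'', ''c''} \<longrightarrow> regs s' x = regs s x) \<and>
     (\<forall>a<BB. mem s' a = mem s a)"

text \<open>Quantifies over all agreeing states because earlier rounds have already filled part of
  the next table.\<close>

definition computes :: "state \<Rightarrow> nat \<Rightarrow> nat \<Rightarrow> prog \<Rightarrow> (nat \<Rightarrow> nat) \<Rightarrow> bool" where
  "computes s tb m body F \<longleftrightarrow> (\<forall>y s'. y < m \<longrightarrow> agree s s' \<longrightarrow> regs s' ''y'' = y \<longrightarrow>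
     runs w body s' (\<lambda>t s''. t \<le> tb \<and> agree s s'' \<and> mem s'' = mem s' \<and>
       regs s'' ''y'' = y \<and> regs s'' ''r'' = F y))"

lemma N_le_XN: "N \<le> X * N" and X_le_XN: "X \<le> X * N"
  using X_pos N_pos by simp_all

lemma less_word: "v \<le> BB + 4 * (X * N) + 4 \<Longrightarrow> v < 2 ^ w"
  using word by linarith

lemma runs_table_op:
  assumes s: "static s" "regs s ''M'' = M" "M \<le> X"
    and body: "computes s tb (M * N) body F" and F: "\<And>y. F y \<le> N"
  shows "runs w (table_op body) s (\<lambda>t s'. t \<le> M * N * (tb + 30) + 30 \<and>
      frame s s' \<and> static s' \<and> holds s' F (M * N))"
proof -
  define cur where "cur = regs s ''c''"
  have cur: "cur \<le> 1" using s by (simp add: cur_def static_def)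
  have MN: "M * N \<le> X * N" using s(3) by simp
  define I where "I j s' \<longleftrightarrow> agree s s' \<and> regs s' ''y'' = j \<and>
      (\<forall>i<j. mem s' (BB + (2 * i + (1 - cur))) = F i)" for j s'
  have ag: "regs s' ''N'' = N" "regs s' ''B'' = BB" "regs s' ''M'' = M" "regs s' ''c'' = cur"
    if "agree s s'" for s'
    using that s by (simp_all add: agree_def static_def cur_def)
  have loop: "fits w (ry <\<^sub>e rM *\<^sub>e rN) s' \<and> eval_expr (ry <\<^sub>e rM *\<^sub>e rN) s' \<noteq> 0 \<and>
      runs w (body ;; Store (rB +\<^sub>e (Lit 2 *\<^sub>e ry +\<^sub>e (Lit 1 -\<^sub>e rcur))) rr ;; Assign ''y'' (ry +\<^sub>e Lit 1)) s'
        (\<lambda>t s''. t \<le> tb + 20 \<and> I (Suc j) s'')"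
    if j: "j < M * N" and I: "I j s'" for j s'
  proof -
    have a: "agree s s'" "regs s' ''y'' = j" using I by (auto simp: I_def)
    have w: "j < 2 ^ w" "M < 2 ^ w" "N < 2 ^ w" "M * N < 2 ^ w" "1 < (2::nat) ^ w"
      using word N_le_XN X_le_XN MN j s(3) by linarith+
    have "runs w body s' (\<lambda>t s''. t \<le> tb \<and> agree s s'' \<and> mem s'' = mem s' \<and>
       regs s'' ''y'' = j \<and> regs s'' ''r'' = F j)"
      using body a j by (auto simp: computes_def)
    then have "runs w (body ;; Store (rB +\<^sub>e (Lit 2 *\<^sub>e ry +\<^sub>e (Lit 1 -\<^sub>e rcur))) rr ;; Assign ''y'' (ry +\<^sub>e Lit 1)) s'
        (\<lambda>t s''. t \<le> tb + 20 \<and> I (Suc j) s'')"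
      unfolding runs_Seq
    proof (rule runs_weaken)
      fix t s''
      assume h: "t \<le> tb \<and> agree s s'' \<and> mem s'' = mem s' \<and> regs s'' ''y'' = j \<and> regs s'' ''r'' = F j"
      then have a'': "agree s s''" by simp
      \<comment> \<open>The two tables use offsets of different parity, so the store cannot hit the
        table being read.\<close>
      have ne: "2 * i + cur \<noteq> 2 * j + (1 - cur)" for i using cur by presburger
      have "I (Suc j) (s''\<lparr>mem := (mem s'')(BB + (2 * j + (1 - cur)) := F j),
            regs := (regs s'')(''y'' := Suc j)\<rparr>)"
        using I h ne unfolding I_def agree_def cur_def[symmetric] by (auto simp: less_Suc_eq)
      moreover have "BB + (2 * j + (1 - cur)) < 2 ^ w" "F j < 2 ^ w" "Suc j < 2 ^ w"
        using word MN j F[of j] N_le_XN cur by linarith+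
      moreover have "cur < 2 ^ w" "2 < (2::nat) ^ w" using cur word by linarith+
      ultimately show "runs w (Store (rB +\<^sub>e (Lit 2 *\<^sub>e ry +\<^sub>e (Lit 1 -\<^sub>e rcur))) rr) s''
          (\<lambda>t' s'''. runs w (Assign ''y'' (ry +\<^sub>e Lit 1)) s'''
            (\<lambda>t'' s4. t + (t' + t'') \<le> tb + 20 \<and> I (Suc j) s4))"
        using h ag[OF a''] w by simp
    qed
    then show ?thesis using a w ag[OF a(1)] j by simp
  qed
  have stop: "fits w (ry <\<^sub>e rM *\<^sub>e rN) s' \<and> eval_expr (ry <\<^sub>e rM *\<^sub>e rN) s' = 0"
    if "I (M * N) s'" for s'
  proof -
    have a: "agree s s'" "regs s' ''y'' = M * N" using that by (auto simp: I_def)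
    have "M < 2 ^ w" "N < 2 ^ w" "M * N < 2 ^ w" "1 < (2::nat) ^ w"
      using word N_le_XN X_le_XN MN s(3) by linarith+
    then show ?thesis using a ag[OF a(1)] by simp
  qed
  have fin: "frame s s'' \<and> static s'' \<and> holds s'' F (M * N)"
    if "I (M * N) s'" "s'' = s'\<lparr>regs := (regs s')(''c'' := 1 - cur)\<rparr>" for s' s''
    using that s F cur by (auto simp: I_def agree_def frame_def static_def holds_def)
  have start: "I 0 (s\<lparr>regs := (regs s)(''y'' := 0)\<rparr>)"
    by (simp add: I_def agree_def)
  have "runs w (While (ry <\<^sub>e rM *\<^sub>e rN)
       (body ;; Store (rB +\<^sub>e (Lit 2 *\<^sub>e ry +\<^sub>e (Lit 1 -\<^sub>e rcur))) rr ;; Assign ''y'' (ry +\<^sub>e Lit 1)))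
       (s\<lparr>regs := (regs s)(''y'' := 0)\<rparr>)
     (\<lambda>t s'. t \<le> M * N * (tb + 30) + 10 \<and> I (M * N) s')"
    by (rule runs_weaken[OF runs_While_counter[of "M * N" I, OF loop stop start]])
      (auto simp: algebra_simps)
  then have "runs w (While (ry <\<^sub>e rM *\<^sub>e rN)
       (body ;; Store (rB +\<^sub>e (Lit 2 *\<^sub>e ry +\<^sub>e (Lit 1 -\<^sub>e rcur))) rr ;; Assign ''y'' (ry +\<^sub>e Lit 1)))
       (s\<lparr>regs := (regs s)(''y'' := 0)\<rparr>)
     (\<lambda>t s'. runs w (Assign ''c'' (Lit 1 -\<^sub>e rcur)) s' (\<lambda>t' s''. t + t' \<le> M * N * (tb + 30) + 20 \<and>
       frame s s'' \<and> static s'' \<and> holds s'' F (M * N)))"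
  proof (rule runs_weaken)
    fix t s'
    assume h: "t \<le> M * N * (tb + 30) + 10 \<and> I (M * N) s'"
    then have "regs s' ''c'' = cur" by (simp add: I_def ag)
    moreover have "cur < 2 ^ w" "1 < (2::nat) ^ w" using cur word by linarith+
    ultimately show "runs w (Assign ''c'' (Lit 1 -\<^sub>e rcur)) s' (\<lambda>t' s''. t + t' \<le> M * N * (tb + 30) + 20 \<and>
       frame s s'' \<and> static s'' \<and> holds s'' F (M * N))"
      using h fin[OF conjunct2[OF h] refl] by simp
  qed
  then show ?thesis unfolding table_op_def runs_Seq runs_Assign[of w "''y''"]
    using word by (auto elim!: runs_weaken)
qed

lemma init_body: "computes s 10 m init_body (init_table N)" if "static s" "m \<le> X * N"
  unfolding computes_def
proof (intro allI impI)
  fix y s'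
  assume h: "y < m" "agree s s'" "regs s' ''y'' = y"
  then have "regs s' ''N'' = N" using \<open>static s\<close> by (simp add: agree_def static_def)
  moreover have "y < 2 ^ w" "N < 2 ^ w" using h that word N_le_XN by linarith+
  ultimately show "runs w init_body s' (\<lambda>t s''. t \<le> 10 \<and> agree s s'' \<and> mem s'' = mem s' \<and>
       regs s'' ''y'' = y \<and> regs s'' ''r'' = init_table N y)"
    using h by (simp add: init_body_def init_table_def agree_def)
qed

text \<open>\<open>m\<close> is the weight of the forgotten bit and \<open>K\<close> the number of
  settings of the bits above it: \<open>2 * (m * K)\<close> rows are read and \<open>m * K\<close>
  rows are written.\<close>

lemma forget_body:
  assumes "static s" "regs s ''p'' = m" "0 < m" "2 * (m * K) \<le> X"
    and T: "holds s T (2 * (m * K) * N)"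
  shows "computes s 100 (m * K * N) forget_body (forget_table N m T)"
  unfolding computes_def
proof (intro allI impI)
  fix y s'
  assume y: "y < m * K * N" and a: "agree s s'" and y': "regs s' ''y'' = y"
  define cur where "cur = regs s ''c''"
  have r: "regs s' ''N'' = N" "regs s' ''B'' = BB" "regs s' ''p'' = m" "regs s' ''c'' = cur" "cur \<le> 1"
    using a assms by (auto simp: agree_def static_def cur_def)
  define x where "x = y div N"
  define d where "d = y mod N"
  define u where "u = x div m"
  define l where "l = x mod m"
  define z where "z = (u * (2 * m) + l) * N + d"
  have d: "d < N" using N_pos by (simp add: d_def)
  have l: "l < m" using \<open>0 < m\<close> by (simp add: l_def)
  have x: "x < m * K" using y by (simp add: x_def less_mult_imp_div_less)
  then have u: "u + 1 \<le> K" by (simp add: u_def less_mult_imp_div_less Suc_le_eq mult.commute)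
  have "u * (2 * m) + l + m < 2 * m * (u + 1)" using l by (simp add: algebra_simps)
  also have "\<dots> \<le> 2 * m * K" using u by (rule mult_le_mono2)
  finally have um: "u * (2 * m) + l + m + 1 \<le> 2 * (m * K)" by simp
  have "(u * (2 * m) + l + m + 1) * N \<le> 2 * (m * K) * N" using um by (rule mult_le_mono1)
  then have z: "z + m * N < 2 * (m * K) * N" using d by (simp add: z_def algebra_simps)
  have XN: "2 * (m * K) * N \<le> X * N" using assms(4) by (rule mult_le_mono1)
  have bd: "u \<le> u * (2 * m)" "x \<le> m * K" using \<open>0 < m\<close> x by simp_all
  have um': "(u * (2 * m) + l) * N \<le> z" by (simp add: z_def)
  have T_le: "T i \<le> N" for i using T by (simp add: holds_def)
  have Tw: "T i < 2 ^ w" for i using T_le[of i] N_le_XN by (intro less_word) linarith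
  have rd: "mem s' (BB + (2 * i + cur)) = T i" if "i < 2 * (m * K) * N" for i
    using a T that by (simp add: agree_def holds_def cur_def)
  \<comment> \<open>\<open>fits\<close> demands a word at every subexpression, so each intermediate
    value gets its own bound; the addresses are controlled by
    \<open>z + m * N < 2 * (m * K) * N \<le> X * N\<close>.\<close>
  have word_facts: "y < 2 ^ w" "x < 2 ^ w" "d < 2 ^ w" "u < 2 ^ w" "l < 2 ^ w" "m < 2 ^ w" "N < 2 ^ w"
    "2 * m < 2 ^ w" "u * (2 * m) < 2 ^ w" "u * (2 * m) + l < 2 ^ w" "(u * (2 * m) + l) * N < 2 ^ w"
    "z < 2 ^ w" "m * N < 2 ^ w" "z + m * N < 2 ^ w" "z + m * N - Suc 0 < 2 ^ w" "Suc 0 < 2 ^ w" "2 < (2::nat) ^ w"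
    "BB < 2 ^ w" "cur < 2 ^ w" "2 * z < 2 ^ w" "2 * z + cur < 2 ^ w" "BB + (2 * z + cur) < 2 ^ w"
    "2 * (z + m * N - Suc 0) < 2 ^ w" "2 * (z + m * N - Suc 0) + cur < 2 ^ w"
    "BB + (2 * (z + m * N - Suc 0) + cur) < 2 ^ w"
    using word XN z um u l d N_le_XN \<open>cur \<le> 1\<close> um' x y assms(4) X_le_XN bd
    by linarith+
  have z_eq: "(y div N div m * (2 * m) + y div N mod m) * N + y mod N = z"
    by (simp add: z_def u_def l_def x_def d_def)
  have z1: "z + m * N - Suc 0 < 2 * (m * K) * N" "z < 2 * (m * K) * N" using z by linarith+
  show "runs w forget_body s' (\<lambda>t s''. t \<le> 100 \<and> agree s s'' \<and> mem s'' = mem s' \<and>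
       regs s'' ''y'' = y \<and> regs s'' ''r'' = forget_table N m T y)"
    unfolding forget_table_def forget_index_def z_eq
    using a y' word_facts
    by (simp add: forget_body_def entry_def r rd[OF z1(1)] rd[OF z1(2)] Tw x_def[symmetric] d_def[symmetric] u_def[symmetric] l_def[symmetric] z_def[symmetric]) (auto simp: agree_def)
qed

lemma insert_body:
  assumes "static s" "regs s ''p'' = m" "0 < m" "2 * (m * K) \<le> X"
    and T: "holds s T (m * K * N)"
  shows "computes s 100 (2 * (m * K) * N) insert_body (insert_table N m T)"
  unfolding computes_def
proof (intro allI impI)
  fix y s'
  assume y: "y < 2 * (m * K) * N" and a: "agree s s'" and y': "regs s' ''y'' = y"
  define cur where "cur = regs s ''c''"
  have r: "regs s' ''N'' = N" "regs s' ''B'' = BB" "regs s' ''p'' = m" "regs s' ''c'' = cur" "cur \<le> 1"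
    using a assms by (auto simp: agree_def static_def cur_def)
  define x where "x = y div N"
  define d where "d = y mod N"
  define u where "u = x div (2 * m)"
  define l where "l = x mod m"
  define z where "z = (u * m + l) * N + d"
  have d: "d < N" using N_pos by (simp add: d_def)
  have l: "l < m" using \<open>0 < m\<close> by (simp add: l_def)
  have x: "x < 2 * (m * K)" using y by (simp only: x_def less_mult_imp_div_less)
  then have "x < K * (2 * m)" by (simp add: ac_simps)
  then have u: "u + 1 \<le> K" by (simp add: u_def less_mult_imp_div_less Suc_le_eq)
  have "u * m + l < m * (u + 1)" using l by (simp add: algebra_simps)
  also have "\<dots> \<le> m * K" using u by (rule mult_le_mono2)
  finally have um: "u * m + l + 1 \<le> m * K" by simp
  have "(u * m + l + 1) * N \<le> m * K * N" using um by (rule mult_le_mono1)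
  then have z: "z < m * K * N" using d by (simp add: z_def algebra_simps)
  have XN: "2 * (m * K) * N \<le> X * N" using assms(4) by (rule mult_le_mono1)
  have "1 \<le> K" using u by simp
  then have bd: "u \<le> u * m" "x div m \<le> x" "m \<le> m * K" using \<open>0 < m\<close> by simp_all
  have um': "(u * m + l) * N \<le> z" by (simp add: z_def)
  have T_le: "T i \<le> N" for i using T by (simp add: holds_def)
  have Tw: "T i < 2 ^ w" for i using T_le[of i] N_le_XN by (intro less_word) linarith
  have rd: "mem s' (BB + (2 * i + cur)) = T i" if "i < m * K * N" for i
    using a T that by (simp add: agree_def holds_def cur_def)
  have word_facts: "y < 2 ^ w" "x < 2 ^ w" "d < 2 ^ w" "u < 2 ^ w" "l < 2 ^ w" "m < 2 ^ w" "N < 2 ^ w"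
    "2 * m < 2 ^ w" "u * m < 2 ^ w" "u * m + l < 2 ^ w" "(u * m + l) * N < 2 ^ w" "x div m < 2 ^ w"
    "z < 2 ^ w" "z - Suc 0 < 2 ^ w" "Suc 0 < 2 ^ w" "2 < (2::nat) ^ w"
    "BB < 2 ^ w" "cur < 2 ^ w" "2 * z < 2 ^ w" "2 * z + cur < 2 ^ w" "BB + (2 * z + cur) < 2 ^ w"
    "2 * (z - Suc 0) < 2 ^ w" "2 * (z - Suc 0) + cur < 2 ^ w"
    "BB + (2 * (z - Suc 0) + cur) < 2 ^ w"
    using word XN z um u l d N_le_XN \<open>cur \<le> 1\<close> um' x y assms(4) X_le_XN bd
    by linarith+
  have z_eq: "(y div N div (2 * m) * m + y div N mod m) * N + y mod N = z"
    by (simp add: z_def u_def l_def x_def d_def)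
  have z1: "z - Suc 0 < m * K * N" using z by linarith
  show "runs w insert_body s' (\<lambda>t s''. t \<le> 100 \<and> agree s s'' \<and> mem s'' = mem s' \<and>
       regs s'' ''y'' = y \<and> regs s'' ''r'' = insert_table N m T y)"
    unfolding insert_table_def insert_index_def z_eq
    using a y' word_facts
    by (simp add: insert_body_def entry_def r rd[OF z1] rd[OF z] Tw x_def[symmetric]
      d_def[symmetric] u_def[symmetric] l_def[symmetric] z_def[symmetric] odd_iff_mod_2_eq_one)
      (auto simp: agree_def)
qed

lemma finish_body:
  assumes "static s" "M \<le> X" and T: "holds s T (M * N)"
    and cap: "\<And>s'. agree s s' \<Longrightarrow> fits w cap s' \<and> eval_expr cap s' = C" "expr_cost cap \<le> 20"
  shows "computes s (100 * N) (M * N) (finish_body cap) (finish_table N C T)"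
  unfolding computes_def
proof (intro allI impI)
  fix y s'
  assume y: "y < M * N" and a: "agree s s'" and y': "regs s' ''y'' = y"
  define cur where "cur = regs s ''c''"
  have cur: "cur \<le> 1" using assms by (auto simp: static_def cur_def)
  have r: "regs s'' ''N'' = N" "regs s'' ''B'' = BB" "regs s'' ''c'' = cur" if "agree s s''" for s''
    using that assms by (auto simp: agree_def static_def cur_def)
  have XN: "M * N \<le> X * N" using assms(2) by (rule mult_le_mono1)
  have T_le: "T i \<le> N" for i using T by (simp add: holds_def)
  have Tw: "T i < 2 ^ w" "T i + 1 < 2 ^ w" for i
    using T_le[of i] N_le_XN word by linarith+
  have best_w: "best T C y j < 2 ^ w" for j
    using best_le[of T C y j] Tw(1)[of y] by (rule le_less_trans)
  have rd: "mem s' (BB + (2 * i + cur)) = T i" if "i < M * N" for i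
    using a T that by (simp add: agree_def holds_def cur_def)
  have word_facts: "y < 2 ^ w" "y mod N < 2 ^ w" "N < 2 ^ w" "Suc 0 < 2 ^ w" "2 < (2::nat) ^ w"
    "BB < 2 ^ w" "cur < 2 ^ w" "2 * y < 2 ^ w" "2 * y + cur < 2 ^ w" "BB + (2 * y + cur) < 2 ^ w"
    using word XN N_le_XN cur y mod_less_eq_dividend[of y N] by linarith+
  let ?loop = "If (cap <\<^sub>e rd) Skip
             (Assign ''z'' (entry (ry +\<^sub>e rd) +\<^sub>e Lit 1) ;;
              If (rz <\<^sub>e rr) (Assign ''r'' rz) Skip) ;;
           Assign ''d'' (rd +\<^sub>e Lit 1)"
  \<comment> \<open>The entry for indegree 0 is loaded before the loop, so register \<open>d\<close>
    runs one ahead of \<open>j\<close>, and \<open>N - 1\<close> rounds reach the last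
    count.\<close>
  define I where "I j s'' \<longleftrightarrow> agree s s'' \<and> mem s'' = mem s' \<and> regs s'' ''y'' = y \<and>
    regs s'' ''d'' = Suc j \<and> regs s'' ''r'' = best T C y j" for j s''
  show "runs w (finish_body cap) s' (\<lambda>t s''. t \<le> 100 * N \<and> agree s s'' \<and> mem s'' = mem s' \<and>
       regs s'' ''y'' = y \<and> regs s'' ''r'' = finish_table N C T y)"
  proof (cases "y mod N = 0")
    case False
    then show ?thesis
      using a y' word_facts N_pos by (simp add: finish_body_def finish_table_def r[OF a]) (simp add: agree_def)
  next
    case True
    \<comment> \<open>Count 0 puts \<open>y\<close> at the start of a row, so all \<open>N\<close>
      entries from there on lie in the same row of the table.\<close>
    have yd: "y + j < M * N" if "j < N" for j
    proof -
      have "y = y div N * N" using True by (metis add.right_neutral div_mult_mod_eq)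
      moreover have "(y div N + 1) * N \<le> M * N"
        using y by (intro mult_le_mono1) (simp add: less_mult_imp_div_less Suc_le_eq)
      ultimately show ?thesis using that by (simp add: algebra_simps)
    qed
    have loop: "fits w (rd <\<^sub>e rN) s'' \<and> eval_expr (rd <\<^sub>e rN) s'' \<noteq> 0 \<and>
       runs w ?loop s'' (\<lambda>t s3. t \<le> 60 \<and> I (Suc j) s3)" if j: "j < N - 1" and I: "I j s''" for j s''
    proof -
      have ag: "agree s s''" using I by (simp add: I_def)
      have j': "Suc j < N" using j by simp
      have addr: "e < 2 ^ w \<and> 2 * e < 2 ^ w \<and> 2 * e + cur < 2 ^ w \<and> BB + (2 * e + cur) < 2 ^ w"
        if "e < X * N" for e
        using that word cur by linarith
      have jw: "y + Suc j < 2 ^ w" "Suc j < 2 ^ w" "Suc (Suc j) < 2 ^ w" "2 * (y + Suc j) < 2 ^ w"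
        "2 * (y + Suc j) + cur < 2 ^ w" "BB + (2 * (y + Suc j) + cur) < 2 ^ w"
        using addr[OF order.strict_trans2[OF yd[OF j'] XN]] word N_le_XN j' by (blast | linarith)+
      have cap': "fits w cap s''" "eval_expr cap s'' = C" using cap(1)[OF ag] by auto
      show ?thesis
        using I j' jw word_facts cap' cap(2) Tw best_w[of j] rd[OF yd[OF j']]
        by (simp add: I_def entry_def r[OF ag] min_def del: mult_Suc_right add_Suc_right)
           (auto simp: agree_def)
    qed
    have stop: "fits w (rd <\<^sub>e rN) s'' \<and> eval_expr (rd <\<^sub>e rN) s'' = 0" if "I (N - 1) s''" for s''
      using that word_facts N_pos r[of s''] by (auto simp: I_def)
    have start: "I 0 (s'\<lparr>regs := (regs s')(''r'' := T y, ''d'' := 1)\<rparr>)"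
      using a y' by (simp add: I_def agree_def)
    have "runs w (While (rd <\<^sub>e rN) ?loop) (s'\<lparr>regs := (regs s')(''r'' := T y, ''d'' := 1)\<rparr>)
       (\<lambda>t s''. t \<le> (N - 1) * 64 + 4 \<and> I (N - 1) s'')"
      by (rule runs_weaken[OF runs_While_counter[of "N - 1" I, OF loop stop start]]) auto
    then have "runs w (While (rd <\<^sub>e rN) ?loop) (s'\<lparr>regs := (regs s')(''r'' := T y, ''d'' := 1)\<rparr>)
       (\<lambda>t s''. 20 + t \<le> 100 * N \<and> agree s s'' \<and> mem s'' = mem s' \<and>
       regs s'' ''y'' = y \<and> regs s'' ''r'' = finish_table N C T y)"
      using N_pos True by (elim runs_weaken) (auto simp: I_def finish_table_def)
    then show ?thesis
      using True a y' word_facts N_pos rd[OF y] Tw[of y]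
      by (simp add: finish_body_def entry_def r[OF a]) (auto elim!: runs_weaken)
  qed
qed
end

section \<open>Correctness and running time\<close>

text \<open>Capacities may be as large as a word, since the program only compares them and never
  computes with them.\<close>

locale orientation_ram = arranged_graph n E c \<pi> for n E c \<pi> +
  fixes w X N :: nat
  assumes X_eq: "X = 2 ^ cutwidth {..<n} E \<pi>" and N_eq: "N = Suc n"
    and big: "100 * (X * N * N) < 2 ^ w" and cap: "\<And>v. v < n \<Longrightarrow> c v < 2 ^ w"
begin

lemma XNN: "N \<le> X * N * N" "X * N \<le> X * N * N" "X \<le> X * N * N" "N * N \<le> X * N * N"
    "1 \<le> X * N * N" "n < N" "1 \<le> X"
proof -
  show X: "1 \<le> X" and N: "n < N" by (simp_all add: N_eq X_eq)
  have "N \<le> N * N" "X \<le> X * N" "X * N \<le> X * N * N" using N by simp_all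
  moreover have "1 * (N * N) \<le> X * (N * N)" using X by (rule mult_le_mono1)
  then have "N * N \<le> X * N * N" by (simp add: mult.assoc)
  ultimately show "N \<le> X * N * N" "X * N \<le> X * N * N" "X \<le> X * N * N" "N * N \<le> X * N * N"
    "1 \<le> X * N * N" using X by linarith+
qed

lemma ram: "ram w N (N * N) X"
  by unfold_locales (use big XNN in linarith)+

sublocale ram w N "N * N" X
  by (rule ram)

definition base :: "state \<Rightarrow> bool" where
  "base s \<longleftrightarrow> static s \<and> regs s ''n'' = n \<and> (\<forall>a<N * N. mem s a = mem (input_state n E c \<pi>) a)"

definition inv :: "nat \<Rightarrow> nat \<Rightarrow> state \<Rightarrow> bool" where
  "inv h r s \<longleftrightarrow> base s \<and> regs s ''h'' = h \<and> regs s ''M'' = 2 ^ length (queue h r) \<and>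
     regs s ''p'' = 2 ^ length (kept h r) \<and>
     (\<exists>T. table h r T \<and> holds s T (2 ^ length (queue h r) * N))"

lemma input_mem:
  assumes "base s"
  shows "v < n \<Longrightarrow> mem s (Suc v) = c v"
    and "v < n \<Longrightarrow> mem s (Suc (n + v)) = \<pi> v"
    and "q < n * n \<Longrightarrow> mem s (Suc (2 * n + q)) = (if {q div n, q mod n} \<in> E then 1 else 0)"
proof -
  have mem: "mem s a = mem (input_state n E c \<pi>) a" if "a < Suc (2 * n) + n * n" for a
    using assms that unfolding base_def by (simp add: N_eq)
  show "v < n \<Longrightarrow> mem s (Suc v) = c v" "v < n \<Longrightarrow> mem s (Suc (n + v)) = \<pi> v"
    by (simp_all add: mem input_state_def)
  show "q < n * n \<Longrightarrow> mem s (Suc (2 * n + q)) = (if {q div n, q mod n} \<in> E then 1 else 0)"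
    by (simp add: mem input_state_def Let_def)
qed

lemma base_frame: "base s \<Longrightarrow> frame s s' \<Longrightarrow> static s' \<Longrightarrow> base s'"
  by (simp add: base_def frame_def)

lemma frame_reg:
  "frame s s' \<Longrightarrow> x \<notin> {''y'', ''r'', ''z'', ''d'', ''c''} \<Longrightarrow> regs s' x = regs s x"
  by (simp add: frame_def)

lemma power_queue_le:
  assumes "h < 2 * n" "r \<le> n * n"
  shows "2 ^ length (queue h r) \<le> X"
  unfolding X_eq using length_queue_le[OF assms] by (rule power_increasing) simp

text \<open>There are at most \<open>X * N\<close> entries; the further factor \<open>N\<close> pays
  for the inner loop of finishing and is charged uniformly to all operations.\<close>

lemma runs_op:
  assumes "base s" "regs s ''M'' = M" "M \<le> X" "computes s tb (M * N) body F" "tb \<le> 100 * N"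
    "\<And>y. F y \<le> N"
  shows "runs w (table_op body) s (\<lambda>t s'. t \<le> 160 * (X * N * N) \<and>
      frame s s' \<and> base s' \<and> holds s' F (M * N))"
proof (rule runs_weaken[OF runs_table_op[of s M tb body F]])
  fix t s'
  assume *: "t \<le> M * N * (tb + 30) + 30 \<and> frame s s' \<and> static s' \<and> holds s' F (M * N)"
  have "tb + 30 \<le> 130 * N" using assms(5) XNN by linarith
  then have "M * N * (tb + 30) \<le> X * N * (130 * N)" using assms(3) by (intro mult_le_mono) auto
  then have "M * N * (tb + 30) + 30 \<le> 160 * (X * N * N)" using XNN by linarith
  then show "t \<le> 160 * (X * N * N) \<and> frame s s' \<and> base s' \<and> holds s' F (M * N)"
    using * base_frame[OF assms(1)] by auto
qed (use assms in \<open>auto simp: base_def\<close>)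

lemma kept_Suc: "kept h (Suc r) = kept h r @ (if active (Suc h) r then [r] else [])"
  by simp

lemma runs_update:
  assumes h: "h < 2 * n" and r: "r < n * n" and inv: "inv h r s"
    and edge: "{r div n, r mod n} \<in> E" and ab: "regs s ''a'' = a r" "regs s ''b'' = b r"
  shows "runs w update s (\<lambda>t s'. t \<le> 260 * (X * N * N) \<and> inv h (Suc r) s' \<and> regs s' ''q'' = regs s ''q'')"
proof -
  define L where "L = length (queue h r)"
  define m where "m = (2::nat) ^ length (kept h r)"
  define Z where "Z = X * N * N"
  have Z: "1 \<le> Z" using XNN by (simp add: Z_def)
  define k where "k = length (filter (active h) [Suc r..<n * n])"
  obtain T where T: "table h r T" "holds s T (2 ^ L * N)"
    using inv by (auto simp: inv_def L_def)
  have base: "base s" and regs: "regs s ''h'' = h" "regs s ''M'' = 2 ^ L" "regs s ''p'' = m"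
    using inv by (auto simp: inv_def L_def m_def)
  have T_le: "T i \<le> N" for i using T by (simp add: holds_def)
  have L: "2 ^ L \<le> X" and L': "2 ^ length (queue h (Suc r)) \<le> X"
    using power_queue_le[OF h, of r] power_queue_le[OF h, of "Suc r"] r by (auto simp: L_def)
  have m0: "0 < m" by (simp add: m_def)
  have ends: "r div n < n" "r mod n < n" using edge_ends[OF r] .
  have ab_le: "a r \<le> 2 * n" "b r \<le> 2 * n" using pi_bounds ends by auto
  \<comment> \<open>The program does not test which end is the left one: for a number with swapped
    ends \<open>b r < a r\<close>, and the two inequalities fail together.\<close>
  have act: "active h' r \<longleftrightarrow> a r \<le> h' \<and> h' + 1 < b r" for h'
    using r edge unfolding active_def by (auto simp: Q_def)
  have small: "v < 2 ^ w" if "v \<le> 10 * (X * N * N)" for v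
    using that big by linarith
  have word: "a r < 2 ^ w" "b r < 2 ^ w" "h < 2 ^ w" "Suc h < 2 ^ w" "Suc (Suc h) < 2 ^ w"
     "2 ^ L < (2::nat) ^ w" "2 < (2::nat) ^ w" "Suc 0 < 2 ^ w" "3 < (2::nat) ^ w"
    using ab_le h L XNN big by linarith+
  consider (keep) "active h r" "active (Suc h) r" | (drop) "active h r" "\<not> active (Suc h) r"
    | (add) "\<not> active h r" "active (Suc h) r" | (none) "\<not> active h r" "\<not> active (Suc h) r" by blast
  then show ?thesis
  proof cases
    case none
    then have "inv h (Suc r) s"
      using inv table_skip[OF r, of h] by (simp add: inv_def)
    then show ?thesis
      using none word regs ab Z unfolding act update_def Z_def[symmetric] by auto
  next
    case keep
    \<comment> \<open>The queue contains \<open>r\<close> besides the kept edges, so the doubled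
      \<open>p\<close> is still at most the number of bit vectors.\<close>
    have "2 * m \<le> 2 ^ length (queue h r)"
      using keep queue_Suc(1)[OF r, of h] by (simp add: m_def power_add)
    then have m: "m < 2 ^ w" "2 * m < 2 ^ w" using L XNN big unfolding L_def by linarith+
    have "inv h (Suc r) (s\<lparr>regs := (regs s)(''p'' := 2 * m)\<rparr>)"
      using keep inv table_skip[OF r, of h] unfolding inv_def m_def
      by (simp add: base_def static_def holds_def)
    then show ?thesis
      using keep word regs ab Z m unfolding act update_def Z_def[symmetric] by auto
  next
    case drop
    have len: "length (queue h r) = Suc (length (queue h (Suc r)))" and
      T': "table h (Suc r) (forget_table N m T)"
      using table_forget[OF r drop T(1)] by (simp_all add: m_def N_eq)
    have M: "2 ^ length (queue h (Suc r)) = m * 2 ^ k"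
      using drop by (simp add: queue_Suc(2)[OF r] m_def k_def power_add)
    have L2: "2 ^ L = 2 * (m * 2 ^ k)" using len M by (simp add: L_def)
    let ?s = "s\<lparr>regs := (regs s)(''M'' := m * 2 ^ k)\<rparr>"
    have base': "base ?s" using base by (simp add: base_def static_def)
    have "computes ?s 100 (m * 2 ^ k * N) forget_body (forget_table N m T)"
      using base' regs m0 L T unfolding L2
      by (intro forget_body) (auto simp: base_def holds_def)
    then have "runs w (table_op forget_body) ?s (\<lambda>t s'. t \<le> 160 * (X * N * N) \<and>
      frame ?s s' \<and> base s' \<and> holds s' (forget_table N m T) (m * 2 ^ k * N))"
      using base' L L2 XNN table_bounds(2)[OF T_le]
      by (intro runs_op[where tb = 100]) auto
    then have "runs w (table_op forget_body) ?s (\<lambda>t s'. t \<le> 160 * (X * N * N) \<and>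
      inv h (Suc r) s' \<and> regs s' ''q'' = regs s ''q'')"
    proof (rule runs_weaken)
      fix t s'
      assume *: "t \<le> 160 * (X * N * N) \<and>
        frame ?s s' \<and> base s' \<and> holds s' (forget_table N m T) (m * 2 ^ k * N)"
      then have fr: "frame ?s s'" by simp
      have "regs s' ''h'' = h" "regs s' ''M'' = m * 2 ^ k" "regs s' ''p'' = m"
        "regs s' ''q'' = regs s ''q''"
        using regs by (simp_all add: frame_reg[OF fr])
      then show "t \<le> 160 * (X * N * N) \<and> inv h (Suc r) s' \<and> regs s' ''q'' = regs s ''q''"
        using * T' drop unfolding inv_def M kept_Suc by (auto simp: m_def)
    qed
    then show ?thesis
      using drop word regs ab Z L2 unfolding act update_def Z_def[symmetric] by (auto elim!: runs_weaken)
  next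
    case add
    have len: "length (queue h (Suc r)) = Suc (length (queue h r))" and
      T': "table h (Suc r) (insert_table N m T)"
      using table_insert[OF r add T(1)] by (simp_all add: m_def N_eq)
    have M: "2 ^ length (queue h r) = m * 2 ^ k"
      using add by (simp add: queue_Suc(1)[OF r] m_def k_def power_add)
    then have L2: "2 ^ L = m * 2 ^ k" by (simp add: L_def)
    have M': "2 ^ length (queue h (Suc r)) = 2 * (m * 2 ^ k)" by (simp add: len M)
    let ?s = "s\<lparr>regs := (regs s)(''M'' := 2 * (m * 2 ^ k))\<rparr>"
    have base': "base ?s" using base by (simp add: base_def static_def)
    have "computes ?s 100 (2 * (m * 2 ^ k) * N) insert_body (insert_table N m T)"
      using base' regs m0 L' T unfolding L2 M'
      by (intro insert_body) (auto simp: base_def holds_def)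
    then have "runs w (table_op insert_body) ?s (\<lambda>t s'. t \<le> 160 * (X * N * N) \<and>
      frame ?s s' \<and> base s' \<and> holds s' (insert_table N m T) (2 * (m * 2 ^ k) * N))"
      using base' L' M' XNN table_bounds(3)[OF T_le]
      by (intro runs_op[where tb = 100]) auto
    then have op: "runs w (table_op insert_body) ?s (\<lambda>t s'. t \<le> 160 * (X * N * N) \<and> regs s' ''p'' = m \<and>
      inv h (Suc r) (s'\<lparr>regs := (regs s')(''p'' := 2 * m)\<rparr>) \<and> regs s' ''q'' = regs s ''q'')"
    proof (rule runs_weaken)
      fix t s'
      assume *: "t \<le> 160 * (X * N * N) \<and>
        frame ?s s' \<and> base s' \<and> holds s' (insert_table N m T) (2 * (m * 2 ^ k) * N)"
      then have fr: "frame ?s s'" by simp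
      have "regs s' ''h'' = h" "regs s' ''M'' = 2 * (m * 2 ^ k)" "regs s' ''p'' = m"
        "regs s' ''q'' = regs s ''q''"
        using regs by (simp_all add: frame_reg[OF fr])
      then show "t \<le> 160 * (X * N * N) \<and> regs s' ''p'' = m \<and>
        inv h (Suc r) (s'\<lparr>regs := (regs s')(''p'' := 2 * m)\<rparr>) \<and> regs s' ''q'' = regs s ''q''"
        using * T' add unfolding inv_def M' kept_Suc
        by (auto simp: m_def base_def static_def holds_def)
    qed
    have "m \<le> m * 2 ^ k" by simp
    then have m: "m < 2 ^ w" "2 * m < 2 ^ w" "2 * (m * 2 ^ k) < 2 ^ w"
      using L' XNN big unfolding M' by linarith+
    show ?thesis
      using add word regs ab Z L2 m op unfolding act update_def Z_def[symmetric] by (auto elim!: runs_weaken)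
  qed
qed

lemma runs_scan:
  assumes h: "h < 2 * n" and r: "r < n * n" and s: "inv h r s" "regs s ''q'' = r"
  shows "runs w scan s (\<lambda>t s'. t \<le> 320 * (X * N * N) \<and> inv h (Suc r) s' \<and> regs s' ''q'' = Suc r)"
proof -
  define Z where "Z = X * N * N"
  have Z: "1 \<le> Z" using XNN by (simp add: Z_def)
  have base: "base s" using s by (simp add: inv_def)
  then have n: "regs s ''n'' = n" by (simp add: base_def)
  have ends: "r div n < n" "r mod n < n" using edge_ends[OF r] .
  have "n * n \<le> N * N" using XNN by (intro mult_le_mono) auto
  moreover have "\<pi> (r div n) \<le> n" "\<pi> (r mod n) \<le> n" using pi_bounds ends by auto
  ultimately have word: "n < 2 ^ w" "r < 2 ^ w" "Suc r < 2 ^ w" "2 * n < 2 ^ w" "2 * n + r < 2 ^ w"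
    "Suc (2 * n + r) < 2 ^ w" "r div n < 2 ^ w" "r mod n < 2 ^ w" "n + r div n < 2 ^ w"
    "n + r mod n < 2 ^ w" "Suc (n + r div n) < 2 ^ w" "Suc (n + r mod n) < 2 ^ w"
    "\<pi> (r div n) < 2 ^ w" "\<pi> (r mod n) < 2 ^ w" "2 * \<pi> (r div n) < 2 ^ w" "2 * \<pi> (r mod n) < 2 ^ w"
    "Suc 0 < 2 ^ w" "2 < (2::nat) ^ w"
    using big XNN r ends by linarith+
  note mem = input_mem(2)[OF base ends(1)] input_mem(2)[OF base ends(2)] input_mem(3)[OF base r]
  show ?thesis
  proof (cases "{r div n, r mod n} \<in> E")
    case False
    then have "\<not> active h' r" for h' unfolding active_def by (simp add: Q_def)
    then have "inv h (Suc r) (s\<lparr>regs := (regs s)(''q'' := Suc r)\<rparr>)"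
      using s table_skip[OF r, of h] by (simp add: inv_def base_def static_def holds_def)
    then show ?thesis
      using False s n word mem Z unfolding scan_def Z_def[symmetric] by simp
  next
    case True
    let ?s = "s\<lparr>regs := (regs s)(''a'' := a r, ''b'' := b r)\<rparr>"
    have "inv h r ?s" using s by (simp add: inv_def base_def static_def holds_def)
    then have "runs w update ?s
        (\<lambda>t s'. t \<le> 260 * (X * N * N) \<and> inv h (Suc r) s' \<and> regs s' ''q'' = regs ?s ''q'')"
      by (rule runs_update[OF h r _ True]) simp_all
    then have "runs w update ?s (\<lambda>t s'. t \<le> 260 * Z \<and> regs s' ''q'' = r \<and>
        inv h (Suc r) (s'\<lparr>regs := (regs s')(''q'' := Suc r)\<rparr>))"
      by (rule runs_weaken) (use s in \<open>auto simp: inv_def base_def static_def holds_def Z_def\<close>)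
    then show ?thesis
      using True s n word mem Z unfolding scan_def Z_def[symmetric]
      by (simp add: position_def) (auto elim!: runs_weaken)
  qed
qed

text \<open>Registers \<open>p\<close> and \<open>q\<close> are absent because every round resets
  them.\<close>

definition outer :: "nat \<Rightarrow> state \<Rightarrow> bool" where
  "outer h s \<longleftrightarrow> base s \<and> regs s ''h'' = h \<and> regs s ''M'' = 2 ^ length (queue h 0) \<and>
     (\<exists>T. table h 0 T \<and> holds s T (2 ^ length (queue h 0) * N))"

text \<open>The table changes its meaning when the vertex at \<open>Suc h\<close> is met. If there
  is none, it still belongs to time \<open>h\<close> at the end of the loop, and
  \<open>table_next\<close> reinterprets it.\<close>

definition finishing :: "nat \<Rightarrow> nat \<Rightarrow> state \<Rightarrow> bool" where
  "finishing h u s \<longleftrightarrow> base s \<and> regs s ''h'' = h \<and> regs s ''v'' = u \<and>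
     regs s ''M'' = 2 ^ length (queue (Suc h) 0) \<and>
     (\<exists>T. (if \<exists>v<u. pos v = Suc h then table (Suc h) 0 T else table h (n * n) T) \<and>
        holds s T (2 ^ length (queue (Suc h) 0) * N))"

lemma runs_finish:
  assumes h: "h < 2 * n" and u: "u < n" and s: "finishing h u s"
  shows "runs w finish s (\<lambda>t s'. t \<le> 220 * (X * N * N) \<and> finishing h (Suc u) s')"
proof -
  define Z where "Z = X * N * N"
  have Z: "1 \<le> Z" using XNN by (simp add: Z_def)
  define K where "K = (2::nat) ^ length (queue (Suc h) 0)"
  have base: "base s" and regs: "regs s ''h'' = h" "regs s ''v'' = u" "regs s ''M'' = K" "regs s ''n'' = n"
    using s by (auto simp: finishing_def base_def K_def)
  have K: "K \<le> X" using power_queue_le[OF h, of "n * n"] by (simp add: K_def queue_next)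
  have "\<pi> u \<le> n" using pi_bounds[OF u] by simp
  then have word: "n < 2 ^ w" "u < 2 ^ w" "Suc u < 2 ^ w" "n + u < 2 ^ w" "Suc (n + u) < 2 ^ w"
    "\<pi> u < 2 ^ w" "2 * \<pi> u < 2 ^ w" "h < 2 ^ w" "Suc h < 2 ^ w" "Suc 0 < 2 ^ w" "2 < (2::nat) ^ w"
    using big XNN u h by linarith+
  obtain T where T: "if \<exists>v<u. pos v = Suc h then table (Suc h) 0 T else table h (n * n) T"
    "holds s T (K * N)" using s by (auto simp: finishing_def K_def)
  show ?thesis
  proof (cases "pos u = Suc h")
    case False
    then have "(\<exists>v<Suc u. pos v = Suc h) \<longleftrightarrow> (\<exists>v<u. pos v = Suc h)" by (auto simp: less_Suc_eq)
    then have "finishing h (Suc u) (s\<lparr>regs := (regs s)(''v'' := Suc u)\<rparr>)"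
      using s by (simp add: finishing_def base_def static_def holds_def)
    then show ?thesis
      using False regs word input_mem(2)[OF base u] Z unfolding finish_def Z_def[symmetric]
      by (simp add: position_def)
  next
    case True
    \<comment> \<open>Positions are distinct, so no earlier vertex has triggered the finishing
      operation.\<close>
    have "\<not> (\<exists>v<u. pos v = Suc h)" using True inj_pi u by (metis less_trans mult_cancel1 nat_less_le zero_neq_numeral)
    with T have "table h (n * n) T" by simp
    then have T': "table (Suc h) 0 (finish_table N (c u) T)"
      unfolding N_eq using u True indeg_le[OF u] by (intro table_finish) simp_all
    have cap_u: "fits w (Load (Lit 1 +\<^sub>e rv)) s' \<and> eval_expr (Load (Lit 1 +\<^sub>e rv)) s' = c u"
      if "agree s s'" for s'
    proof -
      have "Suc u < N * N" using u by (simp add: N_eq)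
      then have "mem s' (Suc u) = c u" "regs s' ''v'' = u"
        using that regs input_mem(1)[OF base u] by (auto simp: agree_def)
      then show ?thesis using word cap[OF u] by simp
    qed
    have "computes s (100 * N) (K * N) (finish_body (Load (Lit 1 +\<^sub>e rv))) (finish_table N (c u) T)"
    proof (rule finish_body)
      show "static s" using base by (simp add: base_def)
    qed (use K T(2) cap_u cap[OF u] in simp_all)
    then have "runs w (table_op (finish_body (Load (Lit 1 +\<^sub>e rv)))) s (\<lambda>t s'. t \<le> 160 * (X * N * N) \<and>
      frame s s' \<and> base s' \<and> holds s' (finish_table N (c u) T) (K * N))"
      using base regs K T(2) table_bounds(4)[of T N] by (intro runs_op[where tb = "100 * N"]) (simp_all add: holds_def)
    then have "runs w (table_op (finish_body (Load (Lit 1 +\<^sub>e rv)))) s (\<lambda>t s'. t \<le> 160 * Z \<and>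
      regs s' ''v'' = u \<and> finishing h (Suc u) (s'\<lparr>regs := (regs s')(''v'' := Suc u)\<rparr>))"
    proof (rule runs_weaken)
      fix t s'
      assume *: "t \<le> 160 * (X * N * N) \<and>
        frame s s' \<and> base s' \<and> holds s' (finish_table N (c u) T) (K * N)"
      then have fr: "frame s s'" by simp
      have "regs s' ''h'' = h" "regs s' ''M'' = K" "regs s' ''v'' = u"
        using regs by (simp_all add: frame_reg[OF fr])
      then show "t \<le> 160 * Z \<and>
          regs s' ''v'' = u \<and> finishing h (Suc u) (s'\<lparr>regs := (regs s')(''v'' := Suc u)\<rparr>)"
        using * T' True
        by (auto simp: finishing_def base_def static_def holds_def K_def Z_def intro!: exI[of _ "finish_table N (c u) T"])
    qed
    then show ?thesis
      using True regs word input_mem(2)[OF base u] Z unfolding finish_def Z_def[symmetric]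
      by (simp add: position_def) (auto elim!: runs_weaken)
  qed
qed

lemma runs_sweep_round:
  assumes h: "h < 2 * n" and s: "outer h s"
  shows "runs w sweep_round s (\<lambda>t s'. t \<le> 600 * (N * N * (X * N * N)) \<and> outer (Suc h) s')"
proof -
  define Z where "Z = X * N * N"
  have Z: "1 \<le> Z" using XNN by (simp add: Z_def)
  have nn: "n * n < N * N" "n \<le> n * n" by (simp_all add: N_eq le_square)
  have word: "n < 2 ^ w" "n * n < 2 ^ w" "Suc h < 2 ^ w" "h < 2 ^ w" "Suc 0 < 2 ^ w"
    using big XNN nn h by linarith+
  define I where "I r s \<longleftrightarrow> inv h r s \<and> regs s ''q'' = r" for r s
  have I_n: "regs s ''n'' = n" if "I r s" for r s using that by (simp add: I_def inv_def base_def)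
  let ?s = "s\<lparr>regs := (regs s)(''q'' := 0, ''p'' := 1)\<rparr>"
  have "runs w (While (rq <\<^sub>e rn *\<^sub>e rn) scan) ?s
      (\<lambda>t s'. t \<le> n * n * (320 * Z + 1 + expr_cost (rq <\<^sub>e rn *\<^sub>e rn)) + 1 +
          expr_cost (rq <\<^sub>e rn *\<^sub>e rn) \<and> I (n * n) s')"
  proof (rule runs_While_counter)
    show "I 0 ?s" using s by (simp add: I_def inv_def outer_def base_def static_def holds_def)
    show "fits w (rq <\<^sub>e rn *\<^sub>e rn) s' \<and> eval_expr (rq <\<^sub>e rn *\<^sub>e rn) s' \<noteq> 0 \<and>
        runs w scan s' (\<lambda>t s'. t \<le> 320 * Z \<and> I (Suc r) s')" if "r < n * n" "I r s'" for r s'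
      using that I_n[OF that(2)] runs_scan[OF h that(1), of s'] word by (simp add: I_def Z_def)
    show "fits w (rq <\<^sub>e rn *\<^sub>e rn) s' \<and> eval_expr (rq <\<^sub>e rn *\<^sub>e rn) s' = 0" if "I (n * n) s'" for s'
      using that I_n[OF that] word by (simp add: I_def)
  qed
  then have scans: "runs w (While (rq <\<^sub>e rn *\<^sub>e rn) scan) ?s
      (\<lambda>t s'. t \<le> n * n * (326 * Z) + 6 \<and> finishing h 0 (s'\<lparr>regs := (regs s')(''v'' := 0)\<rparr>))"
  proof (rule runs_weaken)
    fix t s'
    assume *: "t \<le> n * n * (320 * Z + 1 + expr_cost (rq <\<^sub>e rn *\<^sub>e rn)) + 1 +
          expr_cost (rq <\<^sub>e rn *\<^sub>e rn) \<and> I (n * n) s'"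
    have "n * n * (320 * Z + 1 + 5) \<le> n * n * (326 * Z)" using Z by (intro mult_le_mono2) linarith
    moreover have "expr_cost (rq <\<^sub>e rn *\<^sub>e rn) = 5" by simp
    with * have "t \<le> n * n * (320 * Z + 1 + 5) + 1 + 5" by metis
    ultimately have "t \<le> n * n * (326 * Z) + 6" by linarith
    then show "t \<le> n * n * (326 * Z) + 6 \<and> finishing h 0 (s'\<lparr>regs := (regs s')(''v'' := 0)\<rparr>)"
      using * by (simp add: I_def inv_def finishing_def base_def static_def holds_def queue_next)
  qed
  have F_n: "regs s ''n'' = n" "regs s ''v'' = u" if "finishing h u s" for u s
    using that by (simp_all add: finishing_def base_def)
  have finishes: "runs w (While (rv <\<^sub>e rn) finish) s'
      (\<lambda>t s'. t \<le> n * n * (224 * Z) + 4 \<and> regs s' ''h'' = h \<and>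
         outer (Suc h) (s'\<lparr>regs := (regs s')(''h'' := Suc h)\<rparr>))" if "finishing h 0 s'" for s'
  proof -
    have "runs w (While (rv <\<^sub>e rn) finish) s'
      (\<lambda>t s'. t \<le> n * (220 * Z + 1 + expr_cost (rv <\<^sub>e rn)) + 1 + expr_cost (rv <\<^sub>e rn) \<and> finishing h n s')"
    proof (rule runs_While_counter[of n "finishing h"])
      show "fits w (rv <\<^sub>e rn) s' \<and> eval_expr (rv <\<^sub>e rn) s' \<noteq> 0 \<and>
          runs w finish s' (\<lambda>t s'. t \<le> 220 * Z \<and> finishing h (Suc u) s')"
        if "u < n" "finishing h u s'" for u s'
        using that F_n[OF that(2)] runs_finish[OF h that] word by (simp add: Z_def)
      show "fits w (rv <\<^sub>e rn) s' \<and> eval_expr (rv <\<^sub>e rn) s' = 0" if "finishing h n s'" for s'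
        using F_n[OF that] word by simp
    qed (rule that)
    then show ?thesis
    proof (rule runs_weaken)
      fix t s'
      assume *: "t \<le> n * (220 * Z + 1 + expr_cost (rv <\<^sub>e rn)) + 1 + expr_cost (rv <\<^sub>e rn) \<and> finishing h n s'"
      then obtain T where T: "if \<exists>v<n. pos v = Suc h then table (Suc h) 0 T else table h (n * n) T"
        "holds s' T (2 ^ length (queue (Suc h) 0) * N)" by (auto simp: finishing_def)
      have "table (Suc h) 0 T"
        using T(1) table_next[of h T] h by (cases "\<exists>v<n. pos v = Suc h") auto
      moreover have "t \<le> n * n * (224 * Z) + 4"
      proof -
        have "expr_cost (rv <\<^sub>e rn) = 3" by simp
        then have "t \<le> n * (220 * Z + 1 + 3) + 1 + 3" using * by metis
        moreover have "n * (220 * Z + 1 + 3) \<le> n * n * (224 * Z)"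
          using Z nn by (intro mult_le_mono) linarith+
        ultimately show ?thesis by linarith
      qed
      ultimately show "t \<le> n * n * (224 * Z) + 4 \<and> regs s' ''h'' = h \<and>
         outer (Suc h) (s'\<lparr>regs := (regs s')(''h'' := Suc h)\<rparr>)"
        using * T(2) by (auto simp: finishing_def outer_def base_def static_def holds_def)
    qed
  qed
  have time: "t + t' + 10 \<le> 600 * (N * N * Z)"
    if "t \<le> n * n * (326 * Z) + 6" "t' \<le> n * n * (224 * Z) + 4" for t t'
  proof -
    \<comment> \<open>The surplus \<open>Z\<close>, available because \<open>n * n < N * N\<close>,
      absorbs the constants; \<open>326 + 224\<close> leaves room below 600.\<close>
    have "n * n * Z + Z = (n * n + 1) * Z" by simp
    also have "\<dots> \<le> N * N * Z" using nn by (intro mult_le_mono1) simp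
    finally show ?thesis using Z that by linarith
  qed
  show ?thesis
    unfolding sweep_round_def Z_def[symmetric] using scans word
    by (auto elim!: runs_weaken intro!: runs_weaken[OF finishes]) (drule (1) time, simp)
qed

lemma runs_min_orientation_prog:
  "runs w min_orientation_prog (input_state n E c \<pi>) (\<lambda>t s.
     t \<le> 2000 * (N * N * N * (X * N * N)) \<and> output_value s = min_orientation_size {..<n} E c)"
proof -
  define Z where "Z = X * N * N"
  define Y where "Y = N * N * Z"
  have Z: "1 \<le> Z" using XNN by (simp add: Z_def)
  have "1 * Z \<le> N * N * Z" by (intro mult_le_mono1) (simp add: N_eq)
  then have Y: "Z \<le> Y" by (simp add: Y_def)
  have word: "n < 2 ^ w" "N < 2 ^ w" "2 * n < 2 ^ w" "N * N < 2 ^ w" "Suc 0 < 2 ^ w" "2 < (2::nat) ^ w"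
    using big XNN by linarith+
  let ?s = "(input_state n E c \<pi>)\<lparr>regs := (\<lambda>x. 0)(''n'' := n, ''N'' := N, ''B'' := N * N, ''M'' := 1)\<rparr>"
  have base: "base ?s" by (simp add: base_def static_def)
  have "runs w (table_op init_body) ?s (\<lambda>t s'. t \<le> 160 * (X * N * N) \<and>
      frame ?s s' \<and> base s' \<and> holds s' (init_table N) (1 * N))"
  proof (rule runs_op[where tb = 10])
    show "computes ?s 10 (1 * N) init_body (init_table N)"
      using base XNN by (intro init_body) (simp_all add: base_def)
  qed (use base XNN table_bounds(1)[of "\<lambda>_. 0"] in simp_all)
  then have init: "runs w (table_op init_body) ?s (\<lambda>t s'. t \<le> 160 * Z \<and> outer 0 s')"
  proof (rule runs_weaken)
    fix t s'
    assume *: "t \<le> 160 * (X * N * N) \<and>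
      frame ?s s' \<and> base s' \<and> holds s' (init_table N) (1 * N)"
    then have fr: "frame ?s s'" by simp
    have "regs s' ''h'' = 0" "regs s' ''M'' = 1" by (simp_all add: frame_reg[OF fr])
    then show "t \<le> 160 * Z \<and> outer 0 s'"
      using * table_init[folded N_eq] by (auto simp: outer_def queue_start Z_def)
  qed
  have O_n: "regs s ''n'' = n" "regs s ''h'' = h" if "outer h s" for h s
    using that by (simp_all add: outer_def base_def)
  have rounds: "runs w (While (rh <\<^sub>e Lit 2 *\<^sub>e rn) sweep_round) s'
      (\<lambda>t s'. t \<le> 2 * n * (600 * Y + 1 + expr_cost (rh <\<^sub>e Lit 2 *\<^sub>e rn)) + 1 +
        expr_cost (rh <\<^sub>e Lit 2 *\<^sub>e rn) \<and> outer (2 * n) s')" if "outer 0 s'" for s'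
  proof (rule runs_While_counter[of "2 * n" outer])
    show "fits w (rh <\<^sub>e Lit 2 *\<^sub>e rn) s \<and> eval_expr (rh <\<^sub>e Lit 2 *\<^sub>e rn) s \<noteq> 0 \<and>
        runs w sweep_round s (\<lambda>t s'. t \<le> 600 * Y \<and> outer (Suc h) s')" if "h < 2 * n" "outer h s" for h s
      using that O_n[OF that(2)] runs_sweep_round[OF that] word by (simp add: Z_def Y_def)
    show "fits w (rh <\<^sub>e Lit 2 *\<^sub>e rn) s \<and> eval_expr (rh <\<^sub>e Lit 2 *\<^sub>e rn) s = 0" if "outer (2 * n) s" for s
      using O_n[OF that] word by simp
  qed (rule that)
  have finale: "runs w (Assign ''size'' (entry (Lit 0)) ;; Assign ''feasible'' (Reg ''size'' <\<^sub>e rN)) s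
      (\<lambda>t s'. t \<le> 20 \<and> output_value s' = min_orientation_size {..<n} E c)" if s: "outer (2 * n) s" for s
  proof -
    obtain T where T: "table (2 * n) 0 T" "holds s T N"
      using s by (auto simp: outer_def queue_stop)
    have st: "regs s ''N'' = N" "regs s ''B'' = N * N" "regs s ''c'' \<le> 1"
      using s by (auto simp: outer_def base_def static_def)
    have "mem s (N * N + (2 * 0 + regs s ''c'')) = T 0" "T 0 \<le> N"
      using T(2) XNN unfolding holds_def by blast+
    moreover have "regs s ''c'' < 2 ^ w" "N * N + regs s ''c'' < 2 ^ w" "T 0 < 2 ^ w"
      using st \<open>T 0 \<le> N\<close> big XNN by linarith+
    moreover have "min_orientation_size {..<n} E c = (if T 0 \<le> n then Some (T 0) else None)"
      by (rule min_orientation_size_eq) (rule table_final[OF T(1)])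
    ultimately show ?thesis
      using st word by (auto simp: entry_def output_value_def N_eq less_Suc_eq_le)
  qed
  have time: "t1 + t2 + t3 + 40 \<le> 2000 * (N * Y)"
    if "t1 \<le> 160 * Z" "t2 \<le> 2 * n * (600 * Y + 1 + expr_cost (rh <\<^sub>e Lit 2 *\<^sub>e rn)) + 1 +
        expr_cost (rh <\<^sub>e Lit 2 *\<^sub>e rn)" "t3 \<le> 20" for t1 t2 t3
  proof -
    have "expr_cost (rh <\<^sub>e Lit 2 *\<^sub>e rn) = 5" by simp
    then have "t2 \<le> 2 * n * (600 * Y + 1 + 5) + 1 + 5" using that(2) by metis
    also have "2 * n * (600 * Y + 1 + 5) \<le> 2 * n * (606 * Y)" using Z Y by (intro mult_le_mono2) linarith
    finally have "t2 \<le> 1212 * (n * Y) + 6" by simp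
    \<comment> \<open>The extra \<open>Y\<close> pays for the initial table, the output and the
      constants.\<close>
    moreover have "N * Y = n * Y + Y" by (simp add: N_eq)
    ultimately show ?thesis using that(1,3) Z Y by linarith
  qed
  let ?W = "While (rh <\<^sub>e Lit 2 *\<^sub>e rn) sweep_round"
  let ?O = "Assign ''size'' (entry (Lit 0)) ;; Assign ''feasible'' (Reg ''size'' <\<^sub>e rN)"
  have main: "runs w (table_op init_body ;; ?W ;; ?O) ?s (\<lambda>t s. t + 20 \<le> 2000 * (N * Y) \<and>
      output_value s = min_orientation_size {..<n} E c)"
    unfolding runs_Seq[of w "table_op init_body" "?W ;; ?O"] runs_Seq[of w ?W ?O]
  proof (rule runs_weaken[OF init])
    fix t s
    assume 1: "t \<le> 160 * Z \<and> outer 0 s"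
    show "runs w ?W s (\<lambda>t' s'. runs w ?O s' (\<lambda>t'' s''. t + (t' + t'') + 20 \<le> 2000 * (N * Y) \<and>
        output_value s'' = min_orientation_size {..<n} E c))"
    proof (rule runs_weaken[OF rounds])
      fix t' s'
      assume 2: "t' \<le> 2 * n * (600 * Y + 1 + expr_cost (rh <\<^sub>e Lit 2 *\<^sub>e rn)) + 1 +
        expr_cost (rh <\<^sub>e Lit 2 *\<^sub>e rn) \<and> outer (2 * n) s'"
      show "runs w ?O s' (\<lambda>t'' s''. t + (t' + t'') + 20 \<le> 2000 * (N * Y) \<and>
          output_value s'' = min_orientation_size {..<n} E c)"
      proof (rule runs_weaken[OF finale])
        fix t'' :: nat and s''
        assume "t'' \<le> 20 \<and> output_value s'' = min_orientation_size {..<n} E c"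
        then show "t + (t' + t'') + 20 \<le> 2000 * (N * Y) \<and>
            output_value s'' = min_orientation_size {..<n} E c"
          using time[OF conjunct1[OF 1] conjunct1[OF 2], of t''] by simp
      qed (use 2 in simp)
    qed (use 1 in simp)
  qed
  have start: "mem (input_state n E c \<pi>) 0 = n" "regs (input_state n E c \<pi>) = (\<lambda>x. 0)"
    by (simp_all add: input_state_def)
  have "2000 * (N * N * N * (X * N * N)) = 2000 * (N * Y)" by (simp add: Y_def Z_def)
  moreover have "runs w min_orientation_prog (input_state n E c \<pi>) (\<lambda>t s.
     t \<le> 2000 * (N * Y) \<and> output_value s = min_orientation_size {..<n} E c)"
    unfolding min_orientation_prog_def runs_Assign
      runs_Seq[of w "Assign _ _" "_ ;; _"]
    using main word start by (auto simp: N_eq[symmetric] simp del: runs_Seq elim!: runs_weaken)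
  ultimately show ?thesis by (simp only:)
qed

end

theorem theorem7p1:
  "\<exists>(P :: prog) (C :: nat) (k :: nat).
     \<forall>(n :: nat) (E :: nat set set) (c :: nat \<Rightarrow> nat) (\<pi> :: nat \<Rightarrow> nat).
       simple_graph {..<n} E \<and> linear_arrangement {..<n} \<pi> \<longrightarrow>
       (let T = C * 2 ^ cutwidth {..<n} E \<pi> * (n + 1) ^ k in
        \<forall>w. T < 2 ^ w \<and> (\<forall>v<n. c v < 2 ^ w) \<longrightarrow>
          (\<exists>t s. exec w P (input_state n E c \<pi>) t s \<and> t \<le> T \<and>
                 output_value s = min_orientation_size {..<n} E c))"
\<comment> \<open>The exponent 5 collects three factors for \<open>2 * n\<close> half steps over
  \<open>n * n\<close> edge numbers, one for the counts in a row and one for the finishing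
  loop.\<close>
proof (rule exI[of _ min_orientation_prog], rule exI[of _ 2000], rule exI[of _ 5], unfold Let_def,
    intro allI impI)
  fix n w :: nat and E :: "nat set set" and c \<pi> :: "nat \<Rightarrow> nat"
  assume graph: "simple_graph {..<n} E \<and> linear_arrangement {..<n} \<pi>"
    and w: "2000 * 2 ^ cutwidth {..<n} E \<pi> * (n + 1) ^ 5 < 2 ^ w \<and> (\<forall>v<n. c v < 2 ^ w)"
  define X where "X = (2::nat) ^ cutwidth {..<n} E \<pi>"
  have power5: "m ^ 5 = m * m * m * (m * m)" for m :: nat by (simp add: eval_nat_numeral)
  have T: "2000 * X * (n + 1) ^ 5 = 2000 * (Suc n * Suc n * Suc n * (X * Suc n * Suc n))"
    by (simp only: power5 Suc_eq_plus1 ac_simps)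
  \<comment> \<open>The assumption that the time bound is itself a word also makes all addresses and
    table entries fit.\<close>
  have "1 * (X * Suc n * Suc n) \<le> Suc n * Suc n * Suc n * (X * Suc n * Suc n)"
    by (intro mult_le_mono1) simp
  then have "100 * (X * Suc n * Suc n) < 2 ^ w"
    using w unfolding X_def[symmetric] T by linarith
  then interpret orientation_ram n E c \<pi> w X "Suc n"
    by unfold_locales (use graph w in \<open>simp_all add: X_def\<close>)
  show "\<exists>t s. exec w min_orientation_prog (input_state n E c \<pi>) t s \<and>
      t \<le> 2000 * 2 ^ cutwidth {..<n} E \<pi> * (n + 1) ^ 5 \<and>
      output_value s = min_orientation_size {..<n} E c"
    using runs_min_orientation_prog unfolding runs_def X_def[symmetric] T by blast
qed

end
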